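(* Let $A$ be a coercive self-adjoint operator on an infinite-dimensional real Hilbert space $H$ with $A^{-1}$ compact, with eigenvalues $(\lambda_n)_{n\ge1}$, and let $V=D(A^{1/2})$. Assume: (i) for some $\varepsilon>0$, $\delta>0$, one has $\lambda_n\ge\delta n^{\varepsilon}$ for all $n\ge1$; (ii) for some $C>1$, one has $\lambda_{n+1}\le C\lambda_n$ for all $n\ge1$. Let $c>0$ and $\alpha\in(1/2,1)$. Then there exist a solution $u$ of $$u''+Au+cA^{\alpha}u'=0$$ with initial data $u(0)=u_0$, $u'(0)=u_1$, $(u_0,u_1)\in V\times H$, and a function $\delta:(0,\infty)\to(0,\infty)$ (unrelated to the constant in (i)) such that $$\forall k\ge1\ (k\in\mathbb{N}),\ \forall t>0,\quad |A^ku(t)|\ge[\delta(t)\,k]^{\frac{k}{1-\alpha}}.$$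
   Context: $|\cdot|$ and $(\cdot,\cdot)$ denote the norm and inner product of $H$. "Coercive" means there is $a>0$ with $(Aw,w)\ge a|w|^2$ for all $w\in D(A)$. $(\lambda_n)_{n\ge1}$ is the nondecreasing sequence of eigenvalues of $A$, repeated according to multiplicity. Fractional powers are defined by the spectral theorem. Solutions are understood in the energy space: $u\in C([0,\infty);V)\cap C^1([0,\infty);H)$ and, for every $w\in D(A)$, the function $t\mapsto (u'(t),w)$ is $C^1$ on $[0,\infty)$ with $\frac{d}{dt}(u'(t),w)+(u(t),Aw)+c\,(u'(t),A^{\alpha}w)=0$; for each $(u_0,u_1)\in V\times H$ there is exactly one such solution with $u(0)=u_0$, $u'(0)=u_1$. For every such solution, $u(t)\in D(A^k)$ for all $k\in\mathbb{N}$ and $t>0$. *)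

theory Defs
  imports "HOL-Analysis.Analysis"
begin

text \<open>
  The real Hilbert space \<open>H\<close> is the universe of a type of class
  \<open>{real_inner, complete_space}\<close>.  An unbounded operator on \<open>H\<close> is given by its domain \<open>D\<close>
  and a function \<open>A\<close> on the whole type, whose values outside \<open>D\<close> are irrelevant.
\<close>

definition infinite_dimensional :: "'a::real_vector itself \<Rightarrow> bool" where
  "infinite_dimensional _ \<longleftrightarrow> \<not> (\<exists>B::'a set. finite B \<and> span B = UNIV)"

definition linear_operator :: "'a::real_vector set \<Rightarrow> ('a \<Rightarrow> 'a) \<Rightarrow> bool" where
  "linear_operator D A \<longleftrightarrow> subspace D \<and>
     (\<forall>x\<in>D. \<forall>y\<in>D. A (x + y) = A x + A y) \<and> (\<forall>r. \<forall>x\<in>D. A (r *\<^sub>R x) = r *\<^sub>R A x)"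

definition adjoint_graph :: "'a::real_inner set \<Rightarrow> ('a \<Rightarrow> 'a) \<Rightarrow> ('a \<times> 'a) set" where
  "adjoint_graph D A = {(y, z). \<forall>x\<in>D. A x \<bullet> y = x \<bullet> z}"

text \<open>Equality of the graphs includes equality of the domains of \<open>A\<close> and its adjoint.\<close>

definition selfadjoint_operator :: "'a::real_inner set \<Rightarrow> ('a \<Rightarrow> 'a) \<Rightarrow> bool" where
  "selfadjoint_operator D A \<longleftrightarrow> linear_operator D A \<and> closure D = UNIV \<and>
     adjoint_graph D A = {(y, A y) | y. y \<in> D}"

definition coercive_operator :: "'a::real_inner set \<Rightarrow> ('a \<Rightarrow> 'a) \<Rightarrow> bool" where
  "coercive_operator D A \<longleftrightarrow> (\<exists>a>0. \<forall>w\<in>D. A w \<bullet> w \<ge> a * (norm w)\<^sup>2)"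

definition compact_inverse :: "'a::real_normed_vector set \<Rightarrow> ('a \<Rightarrow> 'a) \<Rightarrow> bool" where
  "compact_inverse D A \<longleftrightarrow> bij_betw A D UNIV \<and>
     (\<forall>S. bounded S \<longrightarrow> compact (closure (inv_into D A ` S)))"

definition eigenspace :: "'a::real_vector set \<Rightarrow> ('a \<Rightarrow> 'a) \<Rightarrow> real \<Rightarrow> 'a set" where
  "eigenspace D A \<mu> = {w \<in> D. A w = \<mu> *\<^sub>R w}"

definition eigenvalues :: "'a::real_vector set \<Rightarrow> ('a \<Rightarrow> 'a) \<Rightarrow> real set" where
  "eigenvalues D A = {\<mu>. \<exists>w\<in>eigenspace D A \<mu>. w \<noteq> 0}"

text \<open>
  The sequence is indexed from 1; the value at 0 is irrelevant.  Each real \<open>\<mu>\<close> occurs exactly as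
  often as its multiplicity (not at all if it is not an eigenvalue).  Eigenspaces are
  finite-dimensional when the inverse is compact, so \<open>dim\<close>, which is 0 on
  infinite-dimensional spaces, is the multiplicity.
\<close>

definition eigenvalue_sequence ::
    "'a::real_vector set \<Rightarrow> ('a \<Rightarrow> 'a) \<Rightarrow> (nat \<Rightarrow> real) \<Rightarrow> bool" where
  "eigenvalue_sequence D A l \<longleftrightarrow> mono_on {1..} l \<and>
     (\<forall>\<mu>. finite {n \<in> {1..}. l n = \<mu>} \<and> card {n \<in> {1..}. l n = \<mu>} = dim (eigenspace D A \<mu>))"

definition orth_projection :: "'a::real_inner set \<Rightarrow> 'a \<Rightarrow> 'a" where
  "orth_projection E w = (THE p. p \<in> E \<and> (\<forall>v\<in>E. (w - p) \<bullet> v = 0))"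

text \<open>
  For a positive self-adjoint operator with compact inverse the spectral measure is the sum of
  the point masses \<open>P\<^sub>\<mu>\<close>, the orthogonal projections onto the eigenspaces.  Hence \<open>A\<^sup>s w\<close> is the sum
  of \<open>\<mu>\<^sup>s P\<^sub>\<mu> w\<close> over the eigenvalues, and its domain consists of those \<open>w\<close> for which the sum of
  \<open>\<mu>\<^sup>2\<^sup>s |P\<^sub>\<mu> w|\<^sup>2\<close> is finite.
\<close>

definition frac_dom :: "'a::real_inner set \<Rightarrow> ('a \<Rightarrow> 'a) \<Rightarrow> real \<Rightarrow> 'a set" where
  "frac_dom D A s =
     {w. (\<lambda>\<mu>. \<mu> powr (2 * s) * (norm (orth_projection (eigenspace D A \<mu>) w))\<^sup>2)
           summable_on eigenvalues D A}"

definition frac_power :: "'a::real_inner set \<Rightarrow> ('a \<Rightarrow> 'a) \<Rightarrow> real \<Rightarrow> 'a \<Rightarrow> 'a" where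
  "frac_power D A s w =
     (\<Sum>\<^sub>\<infinity>\<mu>\<in>eigenvalues D A. \<mu> powr s *\<^sub>R orth_projection (eigenspace D A \<mu>) w)"

text \<open>Domain of the iterate \<open>A ^^ k\<close>.\<close>

definition power_domain :: "'a set \<Rightarrow> ('a \<Rightarrow> 'a) \<Rightarrow> nat \<Rightarrow> 'a set" where
  "power_domain D A k = {w. \<forall>j<k. (A ^^ j) w \<in> D}"

text \<open>
  Energy solutions, with \<open>v = u'\<close>; only values at times \<open>t \<ge> 0\<close> matter, and derivatives at 0 are
  one-sided.  Continuity into \<open>V = D(A\<^sup>1\<^sup>/\<^sup>2)\<close> is continuity for the norm \<open>|A\<^sup>1\<^sup>/\<^sup>2 w|\<close>, which is
  equivalent to the graph norm by coercivity.
\<close>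

definition energy_solution ::
    "'a::real_inner set \<Rightarrow> ('a \<Rightarrow> 'a) \<Rightarrow> real \<Rightarrow> real \<Rightarrow> (real \<Rightarrow> 'a) \<Rightarrow> (real \<Rightarrow> 'a) \<Rightarrow> bool" where
  "energy_solution D A c \<alpha> u v \<longleftrightarrow>
     (\<forall>t\<ge>0. u t \<in> frac_dom D A (1/2)) \<and>
     continuous_on {0..} (\<lambda>t. frac_power D A (1/2) (u t)) \<and>
     (\<forall>t\<ge>0. (u has_vector_derivative v t) (at t within {0..})) \<and>
     continuous_on {0..} v \<and>
     (\<forall>w\<in>D. \<exists>g. continuous_on {0..} g \<and>
        (\<forall>t\<ge>0. ((\<lambda>s. v s \<bullet> w) has_real_derivative g t) (at t within {0..}) \<and>
               g t + u t \<bullet> A w + c * (v t \<bullet> frac_power D A \<alpha> w) = 0))"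

end

theory Submission
  imports Defs
begin

text \<open>
  The equation decouples along eigenvectors of \<open>A\<close>: for an eigenvalue \<open>\<mu>\<close> the amplitude satisfies
  \<open>y'' + c \<mu>\<^sup>\<alpha> y' + \<mu> y = 0\<close>. As \<open>\<alpha> > 1/2\<close>, large \<open>\<mu>\<close> are overdamped, and the slow root gives the
  solution \<open>exp (- r t)\<close> with \<open>r\<close> between \<open>\<mu>\<^sup>\<theta> / c\<close> and \<open>2 \<mu>\<^sup>\<theta> / c\<close>, where \<open>\<theta> = 1 - \<alpha>\<close>
  (\<open>slow_root\<close>). High modes therefore decay no faster than a stretched exponential in \<open>\<mu>\<close>, and this
  limits the smoothness of a superposition of slow modes with merely polynomially small coefficients,
  \<open>u(t) = \<Sum> \<mu>\<^sup>-\<^sup>p exp (- r\<^sub>\<mu> t) e\<^sub>\<mu>\<close>, with one unit eigenvector \<open>e\<^sub>\<mu>\<close> for each large eigenvalue.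

  The growth condition makes the negative powers of the eigenvalues square summable, so for a
  sufficiently large \<open>p\<close> the series and its time derivatives converge, with the domination uniform
  in \<open>t \<ge> 0\<close>, and \<open>u\<close> is an energy solution (\<open>modes_energy_solution\<close>). For \<open>t > 0\<close> the lower bound
  on \<open>r\<close> gives \<open>A\<^sup>k u(t) = \<Sum> \<mu>\<^sup>k \<mu>\<^sup>-\<^sup>p exp (- r\<^sub>\<mu> t) e\<^sub>\<mu>\<close> for all \<open>k\<close> (\<open>A_power_synth\<close>). Its norm is at
  least any one of its coefficients. By the ratio condition there is an eigenvalue within a factor \<open>C\<close>
  above \<open>k\<^sup>1\<^sup>/\<^sup>\<theta>\<close> (\<open>sequence_hits_interval\<close>), and its coefficient is at least
  \<open>k\<^sup>k\<^sup>/\<^sup>\<theta>\<close> up to a factor exponential in \<open>k\<close> (\<open>mode_lower_bound\<close>), which is the claim.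

  The convergence of all vector-valued series rests on orthogonality: coefficients have to be
  square summable, and norm estimates follow from termwise domination. Fractional powers of general
  vectors in the domain, which occur in the weak formulation, converge by Bessel's inequality.
\<close>

section \<open>Orthogonal series in a Hilbert space\<close>

text \<open>
  By Pythagoras the squared distance of two nested partial sums is the difference of the partial
  sums of the squared norms, so the Cauchy property carries over from that scalar series.
\<close>

lemma orthogonal_series_summable:
  fixes f :: "'i \<Rightarrow> 'a::{real_inner, complete_space}"
  assumes orth: "\<And>i j. i \<in> I \<Longrightarrow> j \<in> I \<Longrightarrow> i \<noteq> j \<Longrightarrow> f i \<bullet> f j = 0"
    and sq: "(\<lambda>i. (norm (f i))\<^sup>2) summable_on I"
  shows "f summable_on I"
proof -
  let ?g = "\<lambda>i. (norm (f i))\<^sup>2"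
  have pyth: "(norm (sum f F))\<^sup>2 = sum ?g F" if "finite F" "F \<subseteq> I" for F
    using that by (intro norm_sum_Pythagorean) (auto simp: pairwise_def orthogonal_def intro!: orth)
  have "\<exists>P. eventually P (finite_subsets_at_top I) \<and>
            (\<forall>F F'. P F \<and> P F' \<longrightarrow> dist (sum f F) (sum f F') < r)" if "r > 0" for r
  proof -
    define d where "d = (r / 2)\<^sup>2 / 2"
    have "d > 0" using that by (simp add: d_def)
    have "(sum ?g \<longlongrightarrow> infsum ?g I) (finite_subsets_at_top I)"
      using sq by (simp add: has_sum_infsum flip: has_sum_def)
    then have "eventually (\<lambda>F. dist (sum ?g F) (infsum ?g I) < d) (finite_subsets_at_top I)"
      using \<open>d > 0\<close> by (simp add: tendsto_iff)
    then obtain F0 where F0: "finite F0" "F0 \<subseteq> I"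
      and close: "\<And>F. finite F \<Longrightarrow> F0 \<subseteq> F \<Longrightarrow> F \<subseteq> I \<Longrightarrow> dist (sum ?g F) (infsum ?g I) < d"
      by (auto simp: eventually_finite_subsets_at_top)
    define P where "P F \<longleftrightarrow> finite F \<and> F0 \<subseteq> F \<and> F \<subseteq> I" for F
    have tail: "dist (sum f F) (sum f F0) < r / 2" if "P F" for F
    proof -
      have F: "finite F" "F0 \<subseteq> F" "F \<subseteq> I" using that by (auto simp: P_def)
      have "(dist (sum f F) (sum f F0))\<^sup>2 = (norm (sum f (F - F0)))\<^sup>2"
        using F by (simp add: dist_norm sum_diff)
      also have "\<dots> = sum ?g F - sum ?g F0"
        using F by (subst pyth) (auto simp: sum_diff)
      also have "\<dots> < 2 * d"
        using close[OF F] close[OF F0(1) subset_refl F0(2)] unfolding dist_real_def by linarith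
      finally have "(dist (sum f F) (sum f F0))\<^sup>2 < (r / 2)\<^sup>2" by (simp add: d_def)
      then show ?thesis by (rule power2_less_imp_less) (use \<open>r > 0\<close> in simp)
    qed
    have "dist (sum f F) (sum f F') < r" if "P F" "P F'" for F F'
      using tail[OF that(1)] tail[OF that(2)] dist_triangle_half_l by blast
    moreover have "eventually P (finite_subsets_at_top I)"
      using F0 by (auto simp: P_def eventually_finite_subsets_at_top)
    ultimately show ?thesis by blast
  qed
  then have "cauchy_filter (filtermap (sum f) (finite_subsets_at_top I))"
    by (simp add: cauchy_filter_metric_filtermap)
  moreover have "complete (UNIV::'a set)"
    by (meson Cauchy_convergent UNIV_I complete_def convergent_def)
  ultimately obtain L where "(sum f \<longlongrightarrow> L) (finite_subsets_at_top I)"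
    using complete_uniform[where S=UNIV] by (force simp add: filterlim_def)
  then show ?thesis
    using summable_on_def has_sum_def by blast
qed

definition square_summable :: "'i set \<Rightarrow> ('i \<Rightarrow> real) \<Rightarrow> bool" where
  "square_summable I f \<longleftrightarrow> (\<lambda>i. (f i)\<^sup>2) summable_on I"

lemma square_summable_mono:
  assumes "square_summable I b" "\<And>i. i \<in> I \<Longrightarrow> \<bar>f i\<bar> \<le> K * b i"
  shows "square_summable I f"
proof -
  have "(\<lambda>i. K\<^sup>2 * (b i)\<^sup>2) summable_on I"
    using assms(1) by (auto simp: square_summable_def intro: summable_on_cmult_right)
  moreover have "(f i)\<^sup>2 \<le> K\<^sup>2 * (b i)\<^sup>2" if "i \<in> I" for i
    using power_mono[OF assms(2)[OF that], of 2] by (simp add: power_mult_distrib)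
  ultimately show ?thesis
    unfolding square_summable_def by (rule summable_on_comparison_test) auto
qed

locale orthonormal_family =
  fixes I :: "'i set" and e :: "'i \<Rightarrow> 'a::{real_inner, complete_space}"
  assumes unit: "i \<in> I \<Longrightarrow> norm (e i) = 1"
    and orth: "i \<in> I \<Longrightarrow> j \<in> I \<Longrightarrow> i \<noteq> j \<Longrightarrow> e i \<bullet> e j = 0"
begin

text \<open>
  The synthesis operator: an isometry of the square-summable coefficient families onto the closed
  span of the \<open>e i\<close>. It turns every statement below about vectors into one about coefficients.
\<close>

definition synth :: "('i \<Rightarrow> real) \<Rightarrow> 'a" where
  "synth f = (\<Sum>\<^sub>\<infinity>i\<in>I. f i *\<^sub>R e i)"

lemma synth_has_sum:
  assumes "square_summable I f"
  shows "((\<lambda>i. f i *\<^sub>R e i) has_sum synth f) I"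
proof -
  have "(\<lambda>i. (norm (f i *\<^sub>R e i))\<^sup>2) summable_on I \<longleftrightarrow> (\<lambda>i. (f i)\<^sup>2) summable_on I"
    by (rule summable_on_cong) (simp add: unit power_mult_distrib)
  then have sq: "(\<lambda>i. (norm (f i *\<^sub>R e i))\<^sup>2) summable_on I"
    using assms unfolding square_summable_def by (rule iffD2)
  have "(\<lambda>i. f i *\<^sub>R e i) summable_on I"
    by (rule orthogonal_series_summable[OF _ sq]) (simp add: orth)
  then show ?thesis unfolding synth_def by (rule has_sum_infsum)
qed

lemma inner_synth:
  assumes "square_summable I f"
  shows "((\<lambda>i. f i * (e i \<bullet> x)) has_sum (synth f \<bullet> x)) I"
  using has_sum_bounded_linear[OF bounded_linear_inner_left[of x] synth_has_sum[OF assms]]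
  by (simp add: o_def)

lemma inner_synth_eqI:
  assumes f: "square_summable I f" and g: "square_summable I g"
    and eq: "\<And>i. i \<in> I \<Longrightarrow> f i * (e i \<bullet> x) = g i * (e i \<bullet> y)"
  shows "synth f \<bullet> x = synth g \<bullet> y"
proof -
  have "((\<lambda>i. f i * (e i \<bullet> x)) has_sum (synth g \<bullet> y)) I
      \<longleftrightarrow> ((\<lambda>i. g i * (e i \<bullet> y)) has_sum (synth g \<bullet> y)) I"
    by (rule has_sum_cong) (rule eq)
  then have "((\<lambda>i. f i * (e i \<bullet> x)) has_sum (synth g \<bullet> y)) I"
    using inner_synth[OF g] by (rule iffD2)
  with inner_synth[OF f] show ?thesis by (rule has_sum_unique)
qed

lemma synth_add:
  assumes "square_summable I f" "square_summable I g"
  shows "synth (\<lambda>i. f i + g i) = synth f + synth g"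
  using infsumI[OF has_sum_add[OF assms[THEN synth_has_sum]]]
  by (simp add: synth_def scaleR_add_left)

lemma synth_scaleR:
  assumes "square_summable I f"
  shows "synth (\<lambda>i. k * f i) = k *\<^sub>R synth f"
  using infsumI[OF has_sum_bounded_linear[OF bounded_linear_scaleR_right[of k] synth_has_sum[OF assms]]]
  by (simp add: synth_def o_def)

lemma synth_coeff:
  assumes "square_summable I f" "j \<in> I"
  shows "synth f \<bullet> e j = f j"
proof -
  have "((\<lambda>i. f i * (e i \<bullet> e j)) has_sum f j) I \<longleftrightarrow> ((\<lambda>i. f i * (e i \<bullet> e j)) has_sum f j) {j}"
    using assms(2) by (intro has_sum_cong_neutral) (auto simp: orth)
  moreover have "((\<lambda>i. f i * (e i \<bullet> e j)) has_sum f j) {j}"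
    using has_sum_finite[of "{j}" "\<lambda>i. f i * (e i \<bullet> e j)"] unit[OF assms(2)]
    by (simp add: dot_square_norm)
  ultimately show ?thesis
    using inner_synth[OF assms(1), of "e j"] has_sum_unique by blast
qed

lemma coeff_le_norm_synth:
  assumes "square_summable I f" "i \<in> I"
  shows "f i \<le> norm (synth f)"
  using norm_cauchy_schwarz[of "synth f" "e i"] assms by (simp add: synth_coeff unit)

lemma norm_synth:
  assumes "square_summable I f"
  shows "(norm (synth f))\<^sup>2 = (\<Sum>\<^sub>\<infinity>i\<in>I. (f i)\<^sup>2)"
proof -
  have "((\<lambda>i. f i * (e i \<bullet> synth f)) has_sum (synth f \<bullet> synth f)) I"
    by (rule inner_synth[OF assms])
  also have "?this \<longleftrightarrow> ((\<lambda>i. (f i)\<^sup>2) has_sum (norm (synth f))\<^sup>2) I"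
    by (subst has_sum_cong[where g = "\<lambda>i. (f i)\<^sup>2"])
      (auto simp: inner_commute[of "e _"] synth_coeff[OF assms] power2_eq_square dot_square_norm)
  finally show ?thesis by (simp add: infsumI)
qed

text \<open>
  Domination of coefficients replaces absolute convergence: a bound uniform in the index is a
  bound in norm.
\<close>

lemma norm_synth_le:
  assumes "square_summable I b" "\<And>i. i \<in> I \<Longrightarrow> \<bar>f i\<bar> \<le> K * b i" "K \<ge> 0"
  shows "norm (synth f) \<le> K * norm (synth b)"
proof -
  have "square_summable I f" by (rule square_summable_mono[OF assms(1,2)])
  then have "(norm (synth f))\<^sup>2 = (\<Sum>\<^sub>\<infinity>i\<in>I. (f i)\<^sup>2)" by (rule norm_synth)
  also have "\<dots> \<le> (\<Sum>\<^sub>\<infinity>i\<in>I. K\<^sup>2 * (b i)\<^sup>2)"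
  proof (rule infsum_mono)
    show "(\<lambda>i. (f i)\<^sup>2) summable_on I"
      using \<open>square_summable I f\<close> by (simp add: square_summable_def)
    show "(\<lambda>i. K\<^sup>2 * (b i)\<^sup>2) summable_on I"
      using assms(1) by (auto simp: square_summable_def intro: summable_on_cmult_right)
    show "(f i)\<^sup>2 \<le> K\<^sup>2 * (b i)\<^sup>2" if "i \<in> I" for i
      using power_mono[OF assms(2)[OF that], of 2] by (simp add: power_mult_distrib)
  qed
  also have "\<dots> = (K * norm (synth b))\<^sup>2"
    using assms(1) by (simp add: infsum_cmult_right norm_synth power_mult_distrib square_summable_def)
  finally show ?thesis by (rule power2_le_imp_le) (simp add: assms(3))
qed

end

section \<open>Series of decaying exponentials\<close>

text \<open>
  The bound is uniform over all decay rates when \<open>x = r s\<close> and \<open>y = r t\<close>, which is what allows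
  termwise differentiation of a series containing arbitrarily large rates \<open>r\<close>.
\<close>

lemma exp_remainder_quadratic:
  fixes x y :: real
  assumes "x \<ge> 0" "y \<ge> 0"
  shows "\<bar>exp (- x) - exp (- y) + (x - y) * exp (- y)\<bar> \<le> (x - y)\<^sup>2"
proof -
  have lower: "exp (- k) \<ge> 1 - k" for k :: real
    using exp_ge_add_one_self[of "- k"] by simp
  define R where "R = exp (- x) - exp (- y) + (x - y) * exp (- y)"
  have R: "R = exp (- y) * (exp (- (x - y)) - (1 - (x - y)))"
    by (simp add: R_def algebra_simps flip: exp_add)
  then have "R \<ge> 0" using lower[of "x - y"] by simp
  moreover have "R \<le> (x - y)\<^sup>2"
  proof (cases "x \<ge> y")
    case True
    define h where "h = x - y"
    have "h \<ge> 0" using True by (simp add: h_def)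
    have "exp (- h) * (1 + h) \<le> exp (- h) * exp h"
      using exp_ge_add_one_self[of h] by (intro mult_left_mono) auto
    also have "\<dots> = 1" by (simp flip: exp_add)
    also have "1 \<le> (1 - h + h\<^sup>2) * (1 + h)"
      using \<open>h \<ge> 0\<close> by (simp add: algebra_simps power2_eq_square)
    finally have "exp (- h) \<le> 1 - h + h\<^sup>2" using \<open>h \<ge> 0\<close> by simp
    then have "exp (- y) * (exp (- h) - (1 - h)) \<le> 1 * h\<^sup>2"
      using assms lower[of h] by (intro mult_mono) auto
    then show ?thesis using R by (simp add: h_def)
  next
    case False
    define k where "k = y - x"
    have "k \<ge> 0" using False by (simp add: k_def)
    have "R = exp (- x) * (1 - (1 + k) * exp (- k))"
      by (simp add: R_def k_def algebra_simps flip: exp_add)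
    also have "\<dots> \<le> 1 * k\<^sup>2"
    proof (rule mult_mono)
      have "(1 + k) * (1 - k) \<le> (1 + k) * exp (- k)"
        using lower[of k] \<open>k \<ge> 0\<close> by (intro mult_left_mono) auto
      then show "1 - (1 + k) * exp (- k) \<le> k\<^sup>2"
        by (simp add: algebra_simps power2_eq_square)
      have "(1 + k) * exp (- k) \<le> exp k * exp (- k)"
        using exp_ge_add_one_self[of k] by (intro mult_right_mono) auto
      then show "0 \<le> 1 - (1 + k) * exp (- k)" by (simp flip: exp_add)
    qed (use assms in auto)
    finally show ?thesis by (simp add: k_def power2_commute)
  qed
  ultimately show ?thesis by (simp add: R_def)
qed

lemma has_vector_derivative_quadratic_remainder:
  fixes f :: "real \<Rightarrow> 'a::real_normed_vector"
  assumes "\<And>s. s \<in> S \<Longrightarrow> norm (f s - f t - (s - t) *\<^sub>R f') \<le> K * (s - t)\<^sup>2"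
  shows "(f has_vector_derivative f') (at t within S)"
  unfolding has_vector_derivative_def has_derivative_within_alt2
proof (intro conjI allI impI)
  show "bounded_linear (\<lambda>x. x *\<^sub>R f')" by (rule bounded_linear_scaleR_left)
  fix r :: real assume "r > 0"
  have "norm (f s - f t - (s - t) *\<^sub>R f') \<le> r * norm (s - t)"
    if "s \<in> S" "dist s t < r / (\<bar>K\<bar> + 1)" for s
  proof -
    have "norm (f s - f t - (s - t) *\<^sub>R f') \<le> K * (s - t)\<^sup>2" by (rule assms[OF that(1)])
    also have "\<dots> \<le> ((\<bar>K\<bar> + 1) * \<bar>s - t\<bar>) * \<bar>s - t\<bar>"
      by (simp add: mult.assoc power2_eq_square mult_right_mono flip: abs_mult)
    also have "\<dots> \<le> r * \<bar>s - t\<bar>"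
      using that(2) by (intro mult_right_mono) (auto simp: dist_real_def field_simps)
    finally show ?thesis by simp
  qed
  moreover have "r / (\<bar>K\<bar> + 1) > 0" using \<open>r > 0\<close> by simp
  ultimately show "\<forall>\<^sub>F s in at t within S. norm (f s - f t - (s - t) *\<^sub>R f') \<le> r * norm (s - t)"
    unfolding eventually_at by blast
qed

text \<open>
  The remainder of the difference quotient of each term is at most \<open>(r i)\<^sup>2 \<bar>f i\<bar> (s - t)\<^sup>2\<close>; summed
  in norm over the orthonormal family this is still quadratic in \<open>s - t\<close>. The weight \<open>(1 + r i)\<^sup>2\<close>
  covers at once the function, its derivative and this remainder. The derivative is taken
  within the nonnegative times, where the exponentials are bounded by 1.
\<close>

lemma (in orthonormal_family) synth_exp_has_vector_derivative:
  assumes b: "square_summable I (\<lambda>i. (1 + r i)\<^sup>2 * f i)"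
    and r: "\<And>i. i \<in> I \<Longrightarrow> r i \<ge> 0" and "t \<ge> 0"
  shows "((\<lambda>t. synth (\<lambda>i. f i * exp (- r i * t))) has_vector_derivative
           synth (\<lambda>i. - r i * f i * exp (- r i * t))) (at t within {0..})"
proof -
  let ?b = "\<lambda>i. (1 + r i)\<^sup>2 * \<bar>f i\<bar>"
  have b': "square_summable I ?b"
    using b by (simp add: square_summable_def power_mult_distrib)
  have dom: "\<bar>k * f i * exp (- r i * s)\<bar> \<le> 1 * ?b i" if "i \<in> I" "s \<ge> 0" "\<bar>k\<bar> \<le> (1 + r i)\<^sup>2" for i s k
  proof -
    have "\<bar>k * f i * exp (- r i * s)\<bar> = \<bar>k\<bar> * \<bar>f i\<bar> * exp (- r i * s)"
      by (simp add: abs_mult)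
    also have "\<dots> \<le> ?b i * 1"
      using that r[OF that(1)] by (intro mult_mono) auto
    finally show ?thesis by simp
  qed
  have sq: "square_summable I (\<lambda>i. f i * exp (- r i * s))" if "s \<ge> 0" for s
    using r dom[of _ s 1] that by (intro square_summable_mono[OF b', of _ 1]) (auto simp: power2_eq_square algebra_simps)
  have sq': "square_summable I (\<lambda>i. - r i * f i * exp (- r i * s))" if "s \<ge> 0" for s
    using r that by (intro square_summable_mono[OF b' dom]) (auto simp: power2_eq_square algebra_simps)
  show ?thesis
  proof (rule has_vector_derivative_quadratic_remainder[where K = "norm (synth ?b)"])
    fix s :: real assume "s \<in> {0..}"
    then have "s \<ge> 0" by simp
    let ?R = "\<lambda>i. f i * exp (- r i * s) + ((- 1) * (f i * exp (- r i * t))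
                + (- (s - t)) * (- r i * f i * exp (- r i * t)))"
    have split: "synth (\<lambda>i. f i * exp (- r i * s)) - synth (\<lambda>i. f i * exp (- r i * t))
         - (s - t) *\<^sub>R synth (\<lambda>i. - r i * f i * exp (- r i * t)) = synth ?R"
    proof -
      have scaled: "square_summable I (\<lambda>i. k * g i)" if "square_summable I g" for k and g :: "'i \<Rightarrow> real"
        using that by (auto simp: square_summable_def power_mult_distrib intro: summable_on_cmult_right)
      have plus: "square_summable I (\<lambda>i. (- 1) * (f i * exp (- r i * t))
                + (- (s - t)) * (- r i * f i * exp (- r i * t)))"
      proof (rule square_summable_mono[OF b', where K = "1 + \<bar>s - t\<bar>"])
        fix i assume i: "i \<in> I"
        have "\<bar>f i * exp (- r i * t)\<bar> \<le> ?b i"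
          using dom[OF i \<open>t \<ge> 0\<close>, of 1] r[OF i] by (simp add: power2_eq_square algebra_simps)
        moreover have "\<bar>(s - t) * (- r i * f i * exp (- r i * t))\<bar> \<le> \<bar>s - t\<bar> * ?b i"
          unfolding abs_mult[of "s - t"]
          using dom[OF i \<open>t \<ge> 0\<close>, of "- r i"] r[OF i]
          by (intro mult_left_mono) (auto simp: power2_eq_square algebra_simps)
        ultimately show "\<bar>(- 1) * (f i * exp (- r i * t)) + (- (s - t)) * (- r i * f i * exp (- r i * t))\<bar>
            \<le> (1 + \<bar>s - t\<bar>) * ?b i"
          unfolding distrib_right mult_1 minus_mult_left[symmetric] by linarith
      qed
      have "synth ?R = synth (\<lambda>i. f i * exp (- r i * s)) + ((- 1) *\<^sub>R synth (\<lambda>i. f i * exp (- r i * t))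
          + (- (s - t)) *\<^sub>R synth (\<lambda>i. - r i * f i * exp (- r i * t)))"
        using synth_add[OF sq[OF \<open>s \<ge> 0\<close>] plus]
          synth_add[OF scaled[OF sq[OF \<open>t \<ge> 0\<close>], of "- 1"] scaled[OF sq'[OF \<open>t \<ge> 0\<close>], of "- (s - t)"]]
          synth_scaleR[OF sq[OF \<open>t \<ge> 0\<close>], of "- 1"] synth_scaleR[OF sq'[OF \<open>t \<ge> 0\<close>], of "- (s - t)"]
        by (simp only:)
      then show ?thesis by (simp only: scaleR_minus_left scaleR_one) simp
    qed
    have "norm (synth ?R) \<le> (s - t)\<^sup>2 * norm (synth ?b)"
    proof (rule norm_synth_le[OF b'])
      fix i assume i: "i \<in> I"
      have "\<bar>?R i\<bar> = \<bar>f i\<bar> * \<bar>exp (- (r i * s)) - exp (- (r i * t)) + (r i * s - r i * t) * exp (- (r i * t))\<bar>"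
        unfolding abs_mult[symmetric] by (simp add: algebra_simps)
      also have "\<dots> \<le> \<bar>f i\<bar> * (r i * s - r i * t)\<^sup>2"
        using r[OF i] \<open>s \<ge> 0\<close> \<open>t \<ge> 0\<close> by (intro mult_left_mono exp_remainder_quadratic) auto
      also have "\<dots> = (s - t)\<^sup>2 * ((r i)\<^sup>2 * \<bar>f i\<bar>)"
        by (simp add: power2_eq_square algebra_simps)
      also have "\<dots> \<le> (s - t)\<^sup>2 * ?b i"
        using r[OF i] by (intro mult_left_mono mult_right_mono power_mono) auto
      finally show "\<bar>?R i\<bar> \<le> (s - t)\<^sup>2 * ?b i" .
    qed auto
    then show "norm (synth (\<lambda>i. f i * exp (- r i * s)) - synth (\<lambda>i. f i * exp (- r i * t))
         - (s - t) *\<^sub>R synth (\<lambda>i. - r i * f i * exp (- r i * t))) \<le> norm (synth ?b) * (s - t)\<^sup>2"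
      unfolding split by (simp add: mult.commute)
  qed
qed

section \<open>Self-adjoint operators with compact inverse\<close>

lemma minimizer_orthogonal:
  fixes E :: "'a::real_inner set"
  assumes E: "subspace E" and p: "p \<in> E" and min: "\<And>z. z \<in> E \<Longrightarrow> dist w p \<le> dist w z" and "v \<in> E"
  shows "(w - p) \<bullet> v = 0"
proof -
  have le: "(w - p) \<bullet> (y - p) \<le> 0" if "y \<in> E" for y
  proof (rule ccontr)
    assume "\<not> ?thesis"
    then obtain u where "u > 0" "u \<le> 1" "dist (p + u *\<^sub>R (y - p)) w < dist p w"
      using closer_point_lemma[of w p y] by auto
    moreover have "p + u *\<^sub>R (y - p) \<in> E"
      using E p that by (simp add: subspace_add subspace_diff subspace_scale)
    ultimately show False using min[of "p + u *\<^sub>R (y - p)"] by (simp add: dist_commute)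
  qed
  show ?thesis
    using le[of "p + v"] le[of "p - v"] E p \<open>v \<in> E\<close> by (simp add: subspace_add subspace_diff inner_minus_right)
qed

lemma orth_projection_eqI:
  assumes E: "subspace E" and p: "p \<in> E" "\<And>v. v \<in> E \<Longrightarrow> (w - p) \<bullet> v = 0"
  shows "orth_projection E w = p"
  unfolding orth_projection_def
proof (rule the_equality)
  fix q assume q: "q \<in> E \<and> (\<forall>v\<in>E. (w - q) \<bullet> v = 0)"
  then have "q - p \<in> E" using E p(1) by (simp add: subspace_diff)
  then have "(q - p) \<bullet> (q - p) = 0"
    using p(2)[of "q - p"] q by (simp add: inner_diff_left)
  then show "q = p" by simp
qed (use p in auto)

locale coercive_selfadjoint =
  fixes D :: "'a::{real_inner, complete_space} set" and A :: "'a \<Rightarrow> 'a"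
  assumes selfadjoint: "selfadjoint_operator D A"
    and coercive: "coercive_operator D A"
    and compact_inv: "compact_inverse D A"
begin

abbreviation E where "E \<equiv> eigenspace D A"
abbreviation \<sigma> where "\<sigma> \<equiv> eigenvalues D A"
abbreviation P where "P \<mu> \<equiv> orth_projection (E \<mu>)"

lemma subspace_D: "subspace D"
  using selfadjoint by (simp add: selfadjoint_operator_def linear_operator_def)

lemma A_add: "x \<in> D \<Longrightarrow> y \<in> D \<Longrightarrow> A (x + y) = A x + A y"
  using selfadjoint by (simp add: selfadjoint_operator_def linear_operator_def)

lemma A_scaleR: "x \<in> D \<Longrightarrow> A (k *\<^sub>R x) = k *\<^sub>R A x"
  using selfadjoint by (simp add: selfadjoint_operator_def linear_operator_def)

text \<open>
  Self-adjointness is used in this form: membership in the domain can be tested weakly. It gives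
  closedness of the eigenspaces and the action of \<open>A\<close> on infinite sums of eigenvectors.
\<close>

lemma in_domain_iff: "y \<in> D \<and> A y = z \<longleftrightarrow> (\<forall>x\<in>D. A x \<bullet> y = x \<bullet> z)"
proof -
  have "(y, z) \<in> adjoint_graph D A \<longleftrightarrow> (y, z) \<in> {(y, A y) | y. y \<in> D}"
    using selfadjoint by (simp add: selfadjoint_operator_def)
  then show ?thesis by (auto simp: adjoint_graph_def)
qed

lemma symmetric: "x \<in> D \<Longrightarrow> y \<in> D \<Longrightarrow> A x \<bullet> y = x \<bullet> A y"
  using in_domain_iff[of y "A y"] by blast

lemma eigenspace_iff: "w \<in> E \<mu> \<longleftrightarrow> w \<in> D \<and> A w = \<mu> *\<^sub>R w"
  by (simp add: eigenspace_def)

lemma subspace_eigenspace: "subspace (E \<mu>)"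
  using A_scaleR[OF subspace_0[OF subspace_D], of 0] subspace_D
  by (auto intro!: subspaceI simp: eigenspace_iff A_add A_scaleR subspace_add subspace_scale subspace_0 scaleR_add_right)

lemma eigenvectors_orthogonal:
  assumes "x \<in> E \<mu>" "y \<in> E \<nu>" "\<mu> \<noteq> \<nu>"
  shows "x \<bullet> y = 0"
  using symmetric[of x y] assms by (auto simp: eigenspace_iff)

lemma eigenvalues_bounded_below: "\<exists>a>0. \<forall>\<mu>\<in>\<sigma>. a \<le> \<mu>"
proof -
  obtain a where a: "a > 0" "\<And>w. w \<in> D \<Longrightarrow> a * (norm w)\<^sup>2 \<le> A w \<bullet> w"
    using coercive by (auto simp: coercive_operator_def)
  have "a \<le> \<mu>" if "\<mu> \<in> \<sigma>" for \<mu>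
  proof -
    obtain w where w: "w \<in> E \<mu>" "w \<noteq> 0" using \<open>\<mu> \<in> \<sigma>\<close> by (auto simp: eigenvalues_def)
    then show ?thesis using a(2)[of w] by (simp add: eigenspace_iff dot_square_norm)
  qed
  with a(1) show ?thesis by blast
qed

lemma eigenvalue_pos: "\<mu> \<in> \<sigma> \<Longrightarrow> \<mu> > 0"
  using eigenvalues_bounded_below by fastforce

lemma closed_eigenspace: "closed (E \<mu>)"
proof -
  have "E \<mu> = (\<Inter>x\<in>D. {y. (A x - \<mu> *\<^sub>R x) \<bullet> y = 0})"
    using in_domain_iff[of _ "\<mu> *\<^sub>R _"]
    by (auto simp: eigenspace_iff inner_diff_left symmetric)
  then show ?thesis by (auto intro!: closed_INT closed_Collect_eq continuous_intros)
qed

text \<open>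
  On the eigenspace, \<open>x\<close> is the image of \<open>\<mu> x\<close> under the compact inverse. Compactness of balls
  yields the nearest points from which orthogonal projections are built.
\<close>

lemma compact_eigenspace_cball: "compact (E \<mu> \<inter> cball 0 R)"
proof -
  let ?K = "closure (inv_into D A ` cball 0 (\<bar>\<mu>\<bar> * R))"
  have "compact ?K" using compact_inv by (simp add: compact_inverse_def)
  moreover have "E \<mu> \<inter> cball 0 R \<subseteq> ?K"
  proof
    fix x assume x: "x \<in> E \<mu> \<inter> cball 0 R"
    have "inj_on A D" using compact_inv by (simp add: compact_inverse_def bij_betw_def)
    then have inv: "inv_into D A (\<mu> *\<^sub>R x) = x"
      using x inv_into_f_f[of A D x] by (simp add: eigenspace_iff)
    have "norm (\<mu> *\<^sub>R x) \<le> \<bar>\<mu>\<bar> * R" using x unfolding norm_scaleR by (intro mult_left_mono) auto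
    then have "inv_into D A (\<mu> *\<^sub>R x) \<in> inv_into D A ` cball 0 (\<bar>\<mu>\<bar> * R)"
      by (intro imageI) simp
    then show "x \<in> ?K" unfolding inv by (rule subsetD[OF closure_subset])
  qed
  ultimately have "compact (?K \<inter> (E \<mu> \<inter> cball 0 R))"
    by (intro compact_Int_closed closed_Int closed_eigenspace closed_cball)
  then show ?thesis using \<open>_ \<subseteq> ?K\<close> by (simp add: inf.absorb2)
qed

lemma projection_props:
  shows projection_in: "P \<mu> w \<in> E \<mu>"
    and projection_orthogonal: "v \<in> E \<mu> \<Longrightarrow> (w - P \<mu> w) \<bullet> v = 0"
proof -
  let ?K = "E \<mu> \<inter> cball 0 (2 * norm w)"
  have 0: "0 \<in> ?K" using subspace_eigenspace by (simp add: subspace_0)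
  have "\<exists>p\<in>?K. \<forall>z\<in>?K. dist w p \<le> dist w z"
    using 0 by (intro continuous_attains_inf compact_eigenspace_cball continuous_intros) auto
  then obtain p where p: "p \<in> ?K" "\<And>z. z \<in> ?K \<Longrightarrow> dist w p \<le> dist w z" by blast
  have "dist w p \<le> dist w z" if "z \<in> E \<mu>" for z
  proof (cases "z \<in> ?K")
    case False
    then have "2 * norm w < norm z" using that by simp
    then have "dist w 0 \<le> dist w z"
      using norm_triangle_ineq2[of z w] by (simp add: dist_norm norm_minus_commute)
    then show ?thesis using p(2)[OF 0] by linarith
  qed (rule p(2))
  then have orth: "(w - p) \<bullet> v = 0" if "v \<in> E \<mu>" for v
    using p(1) that by (intro minimizer_orthogonal[OF subspace_eigenspace]) auto
  have "P \<mu> w = p"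
    using p(1) orth by (intro orth_projection_eqI subspace_eigenspace) auto
  then show "P \<mu> w \<in> E \<mu>" "v \<in> E \<mu> \<Longrightarrow> (w - P \<mu> w) \<bullet> v = 0"
    using p(1) orth by auto
qed

lemma projection_inner: "v \<in> E \<mu> \<Longrightarrow> P \<mu> w \<bullet> v = w \<bullet> v"
  using projection_orthogonal[of v \<mu> w] by (simp add: inner_diff_left)

text \<open>
  Spectral projections commute with \<open>A\<close>. Together with Bessel's inequality for \<open>A w\<close> this makes
  \<open>\<mu>\<^sup>2 |P\<^sub>\<mu> w|\<^sup>2\<close> summable for \<open>w\<close> in the domain.
\<close>

lemma projection_A:
  assumes "w \<in> D"
  shows "P \<mu> (A w) = \<mu> *\<^sub>R P \<mu> w"
proof (rule orth_projection_eqI[OF subspace_eigenspace])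
  show "\<mu> *\<^sub>R P \<mu> w \<in> E \<mu>" by (simp add: projection_in subspace_eigenspace subspace_scale)
  show "(A w - \<mu> *\<^sub>R P \<mu> w) \<bullet> v = 0" if "v \<in> E \<mu>" for v
    using that assms by (simp add: inner_diff_left projection_inner symmetric eigenspace_iff)
qed

lemma bessel:
  assumes "finite F"
  shows "(\<Sum>\<mu>\<in>F. (norm (P \<mu> w))\<^sup>2) \<le> (norm w)\<^sup>2"
proof -
  define q where "q = (\<Sum>\<mu>\<in>F. P \<mu> w)"
  have q2: "(norm q)\<^sup>2 = (\<Sum>\<mu>\<in>F. (norm (P \<mu> w))\<^sup>2)"
    unfolding q_def using assms
    by (intro norm_sum_Pythagorean)
      (auto simp: pairwise_def orthogonal_def intro!: eigenvectors_orthogonal projection_in)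
  also have "\<dots> = w \<bullet> q"
    unfolding q_def inner_sum_right
    by (intro sum.cong refl) (metis power2_norm_eq_inner projection_in projection_inner)
  finally have "(norm q)\<^sup>2 = w \<bullet> q" .
  moreover have "w \<bullet> q \<le> norm w * norm q" by (rule norm_cauchy_schwarz)
  ultimately have "norm q \<le> norm w"
    by (metis mult_right_le_imp_le norm_ge_zero norm_zero order_le_less power2_eq_square)
  then show ?thesis by (metis norm_ge_zero power_mono q2)
qed

text \<open>
  Without convergence the infinite sum defining the fractional power would be the default value
  0 and the weak equation would lose its damping term. Since the spectrum stays away from 0, the weight
  \<open>\<mu>\<^sup>s\<close> with \<open>s \<le> 1\<close> is dominated by a multiple of \<open>\<mu>\<close>, which Bessel's inequality controls.
\<close>

lemma frac_power_has_sum: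
  assumes "w \<in> D" "s \<le> 1"
  shows "((\<lambda>\<mu>. \<mu> powr s *\<^sub>R P \<mu> w) has_sum frac_power D A s w) \<sigma>"
proof -
  obtain a where a: "a > 0" "\<And>\<mu>. \<mu> \<in> \<sigma> \<Longrightarrow> a \<le> \<mu>" using eigenvalues_bounded_below by blast
  have "(\<lambda>\<mu>. (norm (P \<mu> (A w)))\<^sup>2) summable_on \<sigma>"
    by (intro nonneg_bdd_above_summable_on) (auto intro!: bdd_aboveI2 bessel)
  then have "(\<lambda>\<mu>. (a powr (s - 1))\<^sup>2 * (norm (P \<mu> (A w)))\<^sup>2) summable_on \<sigma>"
    by (rule summable_on_cmult_right)
  then have "(\<lambda>\<mu>. (norm (\<mu> powr s *\<^sub>R P \<mu> w))\<^sup>2) summable_on \<sigma>"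
  proof (rule summable_on_comparison_test)
    fix \<mu> assume \<mu>: "\<mu> \<in> \<sigma>"
    then have "\<mu> > 0" by (rule eigenvalue_pos)
    have "\<mu> powr s = \<mu> powr (s - 1) * \<mu>"
      using \<open>\<mu> > 0\<close> by (simp add: powr_diff)
    moreover have "\<mu> powr (s - 1) \<le> a powr (s - 1)"
      using a \<mu> assms(2) by (intro powr_mono2') auto
    ultimately have "norm (\<mu> powr s *\<^sub>R P \<mu> w) \<le> a powr (s - 1) * norm (P \<mu> (A w))"
      using \<open>\<mu> > 0\<close> projection_A[OF assms(1)] by (simp add: mult.assoc mult_right_mono)
    from power_mono[OF this, of 2]
    show "(norm (\<mu> powr s *\<^sub>R P \<mu> w))\<^sup>2 \<le> (a powr (s - 1))\<^sup>2 * (norm (P \<mu> (A w)))\<^sup>2"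
      by (simp add: power_mult_distrib)
  qed auto
  then have "(\<lambda>\<mu>. \<mu> powr s *\<^sub>R P \<mu> w) summable_on \<sigma>"
    by (rule orthogonal_series_summable[rotated]) (auto intro: eigenvectors_orthogonal[OF projection_in projection_in])
  then show ?thesis by (simp add: frac_power_def)
qed

lemma frac_power_inner_eigenvector:
  assumes "w \<in> D" "s \<le> 1" "\<nu> \<in> \<sigma>" "x \<in> E \<nu>"
  shows "frac_power D A s w \<bullet> x = \<nu> powr s * (w \<bullet> x)"
proof -
  have "((\<lambda>\<mu>. (\<mu> powr s *\<^sub>R P \<mu> w) \<bullet> x) has_sum (frac_power D A s w \<bullet> x)) \<sigma>"
    by (rule has_sum_bounded_linear[OF bounded_linear_inner_left frac_power_has_sum[OF assms(1,2)]])
  moreover have "((\<lambda>\<mu>. (\<mu> powr s *\<^sub>R P \<mu> w) \<bullet> x) has_sum (\<nu> powr s * (w \<bullet> x))) \<sigma>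
      \<longleftrightarrow> ((\<lambda>\<mu>. (\<mu> powr s *\<^sub>R P \<mu> w) \<bullet> x) has_sum (\<nu> powr s * (w \<bullet> x))) {\<nu>}"
    using assms(3,4) eigenvectors_orthogonal[OF projection_in]
    by (intro has_sum_cong_neutral) auto
  moreover have "((\<lambda>\<mu>. (\<mu> powr s *\<^sub>R P \<mu> w) \<bullet> x) has_sum (\<nu> powr s * (w \<bullet> x))) {\<nu>}"
    using has_sum_finite[of "{\<nu>}" "\<lambda>\<mu>. (\<mu> powr s *\<^sub>R P \<mu> w) \<bullet> x"] assms(4)
    by (simp add: projection_inner)
  ultimately show ?thesis using has_sum_unique by blast
qed

end

section \<open>Combinations of eigenvectors\<close>

text \<open>
  One unit eigenvector for each eigenvalue in a set \<open>M\<close>, which serves as its own index set.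
  The solution is built inside the closed span of these eigenvectors, where all operators involved act
  on coefficients.
\<close>

locale eigenvector_family = coercive_selfadjoint +
  fixes M :: "real set" and e :: "real \<Rightarrow> 'a"
  assumes M: "M \<subseteq> \<sigma>"
    and eigenvector: "\<mu> \<in> M \<Longrightarrow> e \<mu> \<in> E \<mu>"
    and normalized: "\<mu> \<in> M \<Longrightarrow> norm (e \<mu>) = 1"
begin

sublocale orthonormal_family M e
  by unfold_locales (auto simp: normalized intro: eigenvectors_orthogonal[OF eigenvector eigenvector])

text \<open>
  The weak characterization of the domain reduces this to \<open>(e\<^sub>\<mu>, A x) = \<mu> (e\<^sub>\<mu>, x)\<close>, term by term.
\<close>

lemma A_synth:
  assumes f: "square_summable M f" and Af: "square_summable M (\<lambda>\<mu>. \<mu> * f \<mu>)"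
  shows "synth f \<in> D \<and> A (synth f) = synth (\<lambda>\<mu>. \<mu> * f \<mu>)"
  unfolding in_domain_iff
proof
  fix x assume x: "x \<in> D"
  have "synth f \<bullet> A x = synth (\<lambda>\<mu>. \<mu> * f \<mu>) \<bullet> x"
  proof (rule inner_synth_eqI[OF f Af])
    fix \<mu> assume "\<mu> \<in> M"
    then show "f \<mu> * (e \<mu> \<bullet> A x) = (\<mu> * f \<mu>) * (e \<mu> \<bullet> x)"
      using eigenvector x symmetric[of "e \<mu>" x] by (simp add: eigenspace_iff)
  qed
  then show "A x \<bullet> synth f = x \<bullet> synth (\<lambda>\<mu>. \<mu> * f \<mu>)" by (simp only: inner_commute)
qed

lemma A_power_synth:
  assumes "\<And>j. square_summable M (\<lambda>\<mu>. \<mu> ^ j * f \<mu>)"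
  shows "(A ^^ k) (synth f) = synth (\<lambda>\<mu>. \<mu> ^ k * f \<mu>)" "synth f \<in> power_domain D A k"
proof -
  have step: "synth (\<lambda>\<mu>. \<mu> ^ j * f \<mu>) \<in> D
      \<and> A (synth (\<lambda>\<mu>. \<mu> ^ j * f \<mu>)) = synth (\<lambda>\<mu>. \<mu> ^ Suc j * f \<mu>)" for j
    using A_synth[OF assms[of j]] assms[of "Suc j"] by (simp add: mult.assoc)
  have iter: "(A ^^ j) (synth f) = synth (\<lambda>\<mu>. \<mu> ^ j * f \<mu>)" for j
    by (induction j) (use step in auto)
  show "(A ^^ k) (synth f) = synth (\<lambda>\<mu>. \<mu> ^ k * f \<mu>)" by (rule iter)
  show "synth f \<in> power_domain D A k" using step by (simp add: power_domain_def iter)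
qed

text \<open>
  The eigenspace may be larger than the line through \<open>e \<nu>\<close>, but the other directions in it are
  orthogonal to all the remaining \<open>e \<mu>\<close>, so the projection sees a single term.
\<close>

lemma projection_synth:
  assumes "square_summable M f"
  shows "P \<nu> (synth f) = (if \<nu> \<in> M then f \<nu> *\<^sub>R e \<nu> else 0)"
proof (rule orth_projection_eqI[OF subspace_eigenspace])
  show "(if \<nu> \<in> M then f \<nu> *\<^sub>R e \<nu> else 0) \<in> E \<nu>"
    using eigenvector subspace_eigenspace by (simp add: subspace_0 subspace_scale)
  fix v assume v: "v \<in> E \<nu>"
  have sum: "((\<lambda>\<mu>. f \<mu> * (e \<mu> \<bullet> v)) has_sum (synth f \<bullet> v)) M" by (rule inner_synth[OF assms])
  have zero: "e \<mu> \<bullet> v = 0" if "\<mu> \<in> M" "\<mu> \<noteq> \<nu>" for \<mu>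
    using eigenvectors_orthogonal[OF eigenvector v] that by blast
  show "(synth f - (if \<nu> \<in> M then f \<nu> *\<^sub>R e \<nu> else 0)) \<bullet> v = 0"
  proof (cases "\<nu> \<in> M")
    case True
    have "((\<lambda>\<mu>. f \<mu> * (e \<mu> \<bullet> v)) has_sum f \<nu> * (e \<nu> \<bullet> v)) M
        \<longleftrightarrow> ((\<lambda>\<mu>. f \<mu> * (e \<mu> \<bullet> v)) has_sum f \<nu> * (e \<nu> \<bullet> v)) {\<nu>}"
      using True zero by (intro has_sum_cong_neutral) auto
    moreover have "((\<lambda>\<mu>. f \<mu> * (e \<mu> \<bullet> v)) has_sum f \<nu> * (e \<nu> \<bullet> v)) {\<nu>}"
      using has_sum_finite[of "{\<nu>}" "\<lambda>\<mu>. f \<mu> * (e \<mu> \<bullet> v)"] by simp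
    ultimately have "synth f \<bullet> v = f \<nu> * (e \<nu> \<bullet> v)" using sum has_sum_unique by blast
    then show ?thesis using True by (simp add: inner_diff_left)
  next
    case False
    have "((\<lambda>\<mu>. f \<mu> * (e \<mu> \<bullet> v)) has_sum 0) M"
      using zero False by (intro has_sum_0) auto
    then have "synth f \<bullet> v = 0" using sum has_sum_unique by blast
    then show ?thesis using False by simp
  qed
qed

lemma frac_power_synth:
  assumes "square_summable M f"
  shows "frac_power D A s (synth f) = synth (\<lambda>\<mu>. \<mu> powr s * f \<mu>)"
  unfolding frac_power_def synth_def[of "\<lambda>\<mu>. \<mu> powr s * f \<mu>"]
  using M by (intro infsum_cong_neutral) (auto simp: projection_synth[OF assms])

lemma synth_in_frac_dom:
  assumes f: "square_summable M f" and sf: "square_summable M (\<lambda>\<mu>. \<mu> powr s * f \<mu>)"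
  shows "synth f \<in> frac_dom D A s"
proof -
  have "(\<lambda>\<mu>. \<mu> powr (2 * s) * (norm (P \<mu> (synth f)))\<^sup>2) summable_on \<sigma>
      \<longleftrightarrow> (\<lambda>\<mu>. (\<mu> powr s * f \<mu>)\<^sup>2) summable_on M"
  proof (rule summable_on_cong_neutral)
    show "\<mu> powr (2 * s) * (norm (P \<mu> (synth f)))\<^sup>2 = (\<mu> powr s * f \<mu>)\<^sup>2" if "\<mu> \<in> \<sigma> \<inter> M" for \<mu>
      using that eigenvalue_pos[of \<mu>]
      by (simp add: projection_synth[OF f] normalized power_mult_distrib powr_power mult.commute)
  qed (use M in \<open>auto simp: projection_synth[OF f]\<close>)
  then show ?thesis using sf by (simp add: frac_dom_def square_summable_def)
qed

lemma synth_inner_frac_power: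
  assumes f: "square_summable M f" and sf: "square_summable M (\<lambda>\<mu>. \<mu> powr s * f \<mu>)"
    and "w \<in> D" "s \<le> 1"
  shows "synth f \<bullet> frac_power D A s w = synth (\<lambda>\<mu>. \<mu> powr s * f \<mu>) \<bullet> w"
proof (rule inner_synth_eqI[OF f sf])
  fix \<mu> assume "\<mu> \<in> M"
  then show "f \<mu> * (e \<mu> \<bullet> frac_power D A s w) = (\<mu> powr s * f \<mu>) * (e \<mu> \<bullet> w)"
    using frac_power_inner_eigenvector[OF assms(3,4) _ eigenvector[of \<mu>]] M
    by (auto simp: inner_commute[of "e \<mu>"])
qed

end

section \<open>The slowly decaying mode of an overdamped oscillator\<close>

text \<open>
  Once the characteristic equation has real roots, the larger one lies between \<open>c \<mu>\<^sup>\<alpha> / 2\<close> and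
  \<open>c \<mu>\<^sup>\<alpha>\<close>, and as the product of the roots is \<open>\<mu>\<close>, the smaller one is comparable to
  \<open>\<mu>\<^sup>1\<^sup>-\<^sup>\<alpha> / c\<close>. The two-sided estimate is what ties the regularity of the solution to the
  exponent \<open>1 - \<alpha>\<close>.
\<close>

lemma slow_root:
  fixes c \<alpha> \<mu> :: real
  assumes "c > 0" "\<mu> > 0" and disc: "4 * \<mu> \<le> (c * \<mu> powr \<alpha>)\<^sup>2"
  shows "\<exists>r. r\<^sup>2 - c * \<mu> powr \<alpha> * r + \<mu> = 0 \<and> \<mu> powr (1 - \<alpha>) / c \<le> r \<and> r \<le> 2 / c * \<mu> powr (1 - \<alpha>)"
proof -
  define m where "m = c * \<mu> powr \<alpha>"
  define r where "r = (m - sqrt (m\<^sup>2 - 4 * \<mu>)) / 2"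
  have m: "m > 0" using assms by (simp add: m_def)
  have sq: "(sqrt (m\<^sup>2 - 4 * \<mu>))\<^sup>2 = m\<^sup>2 - 4 * \<mu>" using disc by (simp add: m_def)
  have "sqrt (m\<^sup>2 - 4 * \<mu>) < sqrt (m\<^sup>2)" using \<open>\<mu> > 0\<close> by (simp only: real_sqrt_less_iff)
  then have "r > 0" using m by (simp add: r_def)
  have "m\<^sup>2 - 4 * \<mu> \<ge> 0" using disc by (simp add: m_def)
  then have half: "r \<le> m / 2" by (simp add: r_def)
  have prod: "r * (m - r) = \<mu>"
    using sq by (simp add: r_def power2_eq_square field_simps)
  have quot: "\<mu> powr (1 - \<alpha>) / c = \<mu> / m"
    using \<open>\<mu> > 0\<close> by (simp add: m_def powr_diff)
  have "\<mu> \<le> r * m" using prod \<open>r > 0\<close> mult_left_mono[of "m - r" m r] by simp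
  then have "\<mu> / m \<le> r" using m by (simp add: divide_le_eq)
  moreover have "r * (m / 2) \<le> r * (m - r)" using half \<open>r > 0\<close> by (intro mult_left_mono) auto
  then have "r \<le> 2 * (\<mu> / m)" using prod m by (simp add: field_simps)
  moreover have "r\<^sup>2 - m * r + \<mu> = 0" using prod by (simp add: power2_eq_square algebra_simps)
  ultimately show ?thesis using quot by (auto simp: m_def intro!: exI[of _ r])
qed

text \<open>
  Stretched-exponential decay beats every power; this is the source of the smoothing for positive
  times.
\<close>

lemma power_exp_bounded:
  fixes \<kappa> \<theta> :: real
  assumes "\<kappa> > 0" "\<theta> > 0"
  shows "\<exists>B. \<forall>x\<ge>1. x ^ j * exp (- \<kappa> * x powr \<theta>) \<le> B"
proof -
  \<comment> \<open>With \<open>n \<ge> j / \<theta>\<close> it suffices that \<open>e\<^sup>z \<ge> (z / n)\<^sup>n\<close>, where \<open>z = \<kappa> x\<^sup>\<theta>\<close>; the summand 1 keeps \<open>n\<close> positive.\<close>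
  obtain n :: nat where n: "real j / \<theta> + 1 \<le> real n" using real_arch_simple by blast
  have "real n \<ge> 1" using n assms by (smt (verit) divide_nonneg_pos of_nat_0_le_iff)
  have "x ^ j * exp (- \<kappa> * x powr \<theta>) \<le> (n / \<kappa>) ^ n" if "x \<ge> 1" for x
  proof -
    define y where "y = \<kappa> * x powr \<theta> / n"
    have "y > 0" using assms \<open>real n \<ge> 1\<close> that by (simp add: y_def)
    have "y ^ n \<le> exp y ^ n"
      using exp_ge_add_one_self[of y] \<open>y > 0\<close> by (intro power_mono) linarith+
    also have "\<dots> = exp (\<kappa> * x powr \<theta>)"
      using \<open>real n \<ge> 1\<close> by (simp add: y_def flip: exp_of_nat_mult)
    finally have y: "y ^ n \<le> exp (\<kappa> * x powr \<theta>)" .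
    have "x ^ j \<le> (x powr \<theta>) ^ n"
    proof -
      have "real j \<le> \<theta> * real n" using n assms by (simp add: field_simps)
      then have "x powr real j \<le> x powr (\<theta> * real n)" using that by (intro powr_mono) auto
      then show ?thesis using that by (simp add: powr_realpow powr_powr[symmetric])
    qed
    also have "\<dots> = (n / \<kappa>) ^ n * y ^ n"
      using assms \<open>real n \<ge> 1\<close> by (simp add: y_def flip: power_mult_distrib)
    also have "\<dots> \<le> (n / \<kappa>) ^ n * exp (\<kappa> * x powr \<theta>)"
      using y assms by (intro mult_left_mono) auto
    finally show ?thesis by (simp add: exp_minus field_simps)
  qed
  then show ?thesis by blast
qed

text \<open>
  For given \<open>k\<close> the best eigenvalue has \<open>\<mu>\<^sup>\<theta>\<close> of order \<open>k\<close>: then \<open>\<mu>\<^sup>k\<close> already has the size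
  \<open>k\<^sup>k\<^sup>/\<^sup>\<theta>\<close>, while the decay over time \<open>t\<close> and the small coefficient \<open>\<mu>\<^sup>-\<^sup>p\<close> cost only factors
  exponential in \<open>k\<close>, which can be absorbed into the base of the power. Taking the maximum with
  \<open>X\<^sub>0\<close> handles the finitely many small \<open>k\<close> with the same constant.
\<close>

lemma mode_lower_bound:
  fixes \<theta> C X\<^sub>0 \<kappa> p r t \<mu> :: real and k :: nat
  assumes \<theta>: "\<theta> > 0" and "C \<ge> 1" "X\<^sub>0 \<ge> 1" "p \<ge> 0" "\<kappa> \<ge> 0" "t \<ge> 0" "k \<ge> 1"
    and X: "X = max X\<^sub>0 (real k powr (1 / \<theta>))" and \<mu>: "X \<le> \<mu>" "\<mu> \<le> C * X"
    and r: "r \<le> \<kappa> * \<mu> powr \<theta>"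
  shows "(exp (- ((C * X\<^sub>0) powr \<theta> * (\<theta> * \<kappa> * t + p))) * real k) powr (real k / \<theta>)
           \<le> \<mu> ^ k * (\<mu> powr (- p) * exp (- r * t))"
proof -
  \<comment> \<open>Chosen so that \<open>\<mu>\<^sup>\<theta> \<le> B k\<close>; both losses are exponentials of multiples of \<open>B k\<close>.\<close>
  define B where "B = (C * X\<^sub>0) powr \<theta>"
  have "\<mu> \<ge> 1" using X \<mu> assms by auto
  have k1: "real k powr (1 / \<theta>) \<ge> 1" using assms by (intro ge_one_powr_ge_zero) auto
  have upper: "\<mu> powr \<theta> \<le> B * k"
  proof -
    have "X \<le> X\<^sub>0 * real k powr (1 / \<theta>)"
      using mult_mono[of 1 X\<^sub>0 "real k powr (1 / \<theta>)" "real k powr (1 / \<theta>)"]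
        mult_mono[of X\<^sub>0 X\<^sub>0 1 "real k powr (1 / \<theta>)"] k1 \<open>X\<^sub>0 \<ge> 1\<close> by (auto simp: X)
    then have "C * X \<le> C * (X\<^sub>0 * real k powr (1 / \<theta>))"
      using \<open>C \<ge> 1\<close> by (intro mult_left_mono) auto
    then have "\<mu> \<le> (C * X\<^sub>0) * real k powr (1 / \<theta>)" using \<mu> by (simp add: mult.assoc)
    then have "\<mu> powr \<theta> \<le> ((C * X\<^sub>0) * real k powr (1 / \<theta>)) powr \<theta>"
      using \<open>\<mu> \<ge> 1\<close> \<theta> by (intro powr_mono2) auto
    also have "\<dots> = B * k"
      using assms by (simp add: B_def powr_mult powr_powr)
    finally show ?thesis .
  qed
  have "real k powr (real k / \<theta>) = (real k powr (1 / \<theta>)) powr real k"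
    by (simp add: powr_powr)
  also have "\<dots> = (real k powr (1 / \<theta>)) ^ k"
    by (rule powr_realpow) (use k1 in linarith)
  also have "\<dots> \<le> \<mu> ^ k"
    using X \<mu> k1 by (intro power_mono) auto
  finally have pow: "real k powr (real k / \<theta>) \<le> \<mu> ^ k" .
  \<comment> \<open>The polynomial loss is made exponential by \<open>ln y \<le> y\<close> at \<open>y = \<mu>\<^sup>\<theta>\<close>.\<close>
  have "exp (- (p / \<theta> * (B * k))) \<le> exp (- p * ln \<mu>)"
  proof -
    have "ln (\<mu> powr \<theta>) \<le> \<mu> powr \<theta>" using \<open>\<mu> \<ge> 1\<close> by (intro ln_bound) auto
    then have "\<theta> * ln \<mu> \<le> B * k" using upper \<open>\<mu> \<ge> 1\<close> by (simp add: ln_powr)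
    then have "p / \<theta> * (\<theta> * ln \<mu>) \<le> p / \<theta> * (B * k)"
      using \<theta> \<open>p \<ge> 0\<close> by (intro mult_left_mono) auto
    then show ?thesis using \<theta> by simp
  qed
  then have coeff: "exp (- (p / \<theta> * (B * k))) \<le> \<mu> powr (- p)"
    using \<open>\<mu> \<ge> 1\<close> by (simp add: powr_def)
  have decay: "exp (- (\<kappa> * (B * k) * t)) \<le> exp (- r * t)"
  proof -
    have "r \<le> \<kappa> * (B * k)" using r mult_left_mono[OF upper \<open>\<kappa> \<ge> 0\<close>] by linarith
    then show ?thesis using \<open>t \<ge> 0\<close> by (simp add: mult_right_mono)
  qed
  have "(exp (- (B * (\<theta> * \<kappa> * t + p))) * real k) powr (real k / \<theta>)
      = exp (- (B * (\<theta> * \<kappa> * t + p)) * (real k / \<theta>)) * real k powr (real k / \<theta>)"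
    by (simp add: powr_mult exp_powr_real)
  also have "- (B * (\<theta> * \<kappa> * t + p)) * (real k / \<theta>) = - (p / \<theta> * (B * k)) + - (\<kappa> * (B * k) * t)"
    using \<theta> by (simp add: field_simps)
  also have "exp \<dots> * real k powr (real k / \<theta>) = real k powr (real k / \<theta>)
      * (exp (- (p / \<theta> * (B * k))) * exp (- (\<kappa> * (B * k) * t)))"
    unfolding exp_add by (rule mult.commute)
  also have "\<dots> \<le> \<mu> ^ k * (\<mu> powr (- p) * exp (- r * t))"
    by (intro mult_mono pow coeff decay) (use \<open>\<mu> \<ge> 1\<close> in auto)
  finally show ?thesis by (simp add: B_def)
qed

section \<open>Superpositions of slow modes\<close>

context eigenvector_family begin

text \<open>
  A superposition of exact scalar solutions solves the equation as soon as the series may be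
  differentiated termwise. Since \<open>r\<close> is at most of order \<open>\<mu>\<close>, each time derivative costs one
  power of \<open>\<mu>\<close> in the coefficients. Four powers suffice: the second derivative takes two,
  and differentiating it once more, which gives its continuity, needs the weight \<open>(1 + r)\<^sup>2\<close>.
\<close>

lemma modes_energy_solution:
  fixes a r :: "real \<Rightarrow> real" and c \<alpha> K :: real
  assumes "\<alpha> \<le> 1" "K \<ge> 0"
    and M1: "\<And>\<mu>. \<mu> \<in> M \<Longrightarrow> 1 \<le> \<mu>"
    and root: "\<And>\<mu>. \<mu> \<in> M \<Longrightarrow> (r \<mu>)\<^sup>2 - c * \<mu> powr \<alpha> * r \<mu> + \<mu> = 0"
    and r0: "\<And>\<mu>. \<mu> \<in> M \<Longrightarrow> 0 \<le> r \<mu>" and rK: "\<And>\<mu>. \<mu> \<in> M \<Longrightarrow> r \<mu> \<le> K * \<mu>"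
    and a: "square_summable M (\<lambda>\<mu>. \<mu> ^ 4 * a \<mu>)"
  shows "energy_solution D A c \<alpha> (\<lambda>t. synth (\<lambda>\<mu>. a \<mu> * exp (- r \<mu> * t)))
           (\<lambda>t. synth (\<lambda>\<mu>. - r \<mu> * a \<mu> * exp (- r \<mu> * t)))"
proof -
  let ?E = "\<lambda>f t. synth (\<lambda>\<mu>. f \<mu> * exp (- r \<mu> * t))"
  have a': "square_summable M (\<lambda>\<mu>. \<mu> ^ 4 * \<bar>a \<mu>\<bar>)"
    using a by (simp add: square_summable_def power_mult_distrib)
  have sq4: "square_summable M (\<lambda>\<mu>. f \<mu> * exp (- r \<mu> * t))"
    if f: "\<And>\<mu>. \<mu> \<in> M \<Longrightarrow> \<bar>f \<mu>\<bar> \<le> L * (\<mu> ^ 4 * \<bar>a \<mu>\<bar>)" and "t \<ge> 0" for f L t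
  proof (rule square_summable_mono[OF a'])
    fix \<mu> assume \<mu>: "\<mu> \<in> M"
    have "\<bar>f \<mu> * exp (- r \<mu> * t)\<bar> \<le> \<bar>f \<mu>\<bar> * 1"
      unfolding abs_mult using r0[OF \<mu>] \<open>t \<ge> 0\<close> by (intro mult_left_mono) auto
    then show "\<bar>f \<mu> * exp (- r \<mu> * t)\<bar> \<le> L * (\<mu> ^ 4 * \<bar>a \<mu>\<bar>)" using f[OF \<mu>] by simp
  qed
  have sq: "square_summable M (\<lambda>\<mu>. f \<mu> * exp (- r \<mu> * t))"
    if f: "\<And>\<mu>. \<mu> \<in> M \<Longrightarrow> \<bar>f \<mu>\<bar> \<le> L * (\<mu>\<^sup>2 * \<bar>a \<mu>\<bar>)" and "t \<ge> 0" "L \<ge> 0" for f L t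
  proof (rule sq4[OF order_trans[OF f] \<open>t \<ge> 0\<close>])
    fix \<mu> assume \<mu>: "\<mu> \<in> M"
    show "L * (\<mu>\<^sup>2 * \<bar>a \<mu>\<bar>) \<le> L * (\<mu> ^ 4 * \<bar>a \<mu>\<bar>)"
      using M1[OF \<mu>] \<open>L \<ge> 0\<close> by (intro mult_left_mono mult_right_mono power_increasing) auto
  qed
  have deriv: "(?E f has_vector_derivative ?E (\<lambda>\<mu>. - r \<mu> * f \<mu>) t) (at t within {0..})"
    if f: "\<And>\<mu>. \<mu> \<in> M \<Longrightarrow> \<bar>f \<mu>\<bar> \<le> L * (\<mu>\<^sup>2 * \<bar>a \<mu>\<bar>)" and "t \<ge> 0" "L \<ge> 0" for f L t
  proof (rule synth_exp_has_vector_derivative[OF _ r0 \<open>t \<ge> 0\<close>])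
    show "square_summable M (\<lambda>\<mu>. (1 + r \<mu>)\<^sup>2 * f \<mu>)"
    proof (rule square_summable_mono[OF a'])
      fix \<mu> assume \<mu>: "\<mu> \<in> M"
      have "(1 + r \<mu>)\<^sup>2 \<le> ((1 + K) * \<mu>)\<^sup>2"
        using r0[OF \<mu>] rK[OF \<mu>] M1[OF \<mu>] by (intro power_mono) (auto simp: algebra_simps)
      then have "(1 + r \<mu>)\<^sup>2 * \<bar>f \<mu>\<bar> \<le> ((1 + K) * \<mu>)\<^sup>2 * (L * (\<mu>\<^sup>2 * \<bar>a \<mu>\<bar>))"
        using f[OF \<mu>] by (intro mult_mono) auto
      then show "\<bar>(1 + r \<mu>)\<^sup>2 * f \<mu>\<bar> \<le> ((1 + K)\<^sup>2 * L) * (\<mu> ^ 4 * \<bar>a \<mu>\<bar>)"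
        by (simp add: abs_mult power_mult_distrib mult_ac power4_eq_xxxx power2_eq_square)
    qed
  qed
  have cont: "continuous_on {0..} (?E f)"
    if f: "\<And>\<mu>. \<mu> \<in> M \<Longrightarrow> \<bar>f \<mu>\<bar> \<le> L * (\<mu>\<^sup>2 * \<bar>a \<mu>\<bar>)" and "L \<ge> 0" for f L
    using has_vector_derivative_continuous[OF deriv[OF f _ \<open>L \<ge> 0\<close>]]
    by (simp add: continuous_on_eq_continuous_within)
  have one: "1 \<le> \<mu>\<^sup>2" if "\<mu> \<in> M" for \<mu>
    using M1[OF that] by simp
  have b0: "\<bar>a \<mu>\<bar> \<le> 1 * (\<mu>\<^sup>2 * \<bar>a \<mu>\<bar>)" if "\<mu> \<in> M" for \<mu>
    using mult_right_mono[OF one[OF that], of "\<bar>a \<mu>\<bar>"] by simp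
  have bs: "\<bar>\<mu> powr s * a \<mu>\<bar> \<le> 1 * (\<mu>\<^sup>2 * \<bar>a \<mu>\<bar>)" if "\<mu> \<in> M" "s \<le> 1" for \<mu> s
  proof -
    have "\<mu> powr s \<le> \<mu> powr 2" using M1[OF that(1)] that(2) by (intro powr_mono) auto
    then show ?thesis using M1[OF that(1)] by (simp add: abs_mult mult_right_mono)
  qed
  have rmu: "r \<mu> \<le> K * \<mu>\<^sup>2" if "\<mu> \<in> M" for \<mu>
  proof -
    have "K * \<mu> \<le> K * \<mu>\<^sup>2" using M1[OF that] \<open>K \<ge> 0\<close> by (intro mult_left_mono) (auto simp: power2_eq_square)
    then show ?thesis using rK[OF that] by linarith
  qed
  have b1: "\<bar>- r \<mu> * a \<mu>\<bar> \<le> K * (\<mu>\<^sup>2 * \<bar>a \<mu>\<bar>)" if "\<mu> \<in> M" for \<mu>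
    using mult_right_mono[OF rmu[OF that], of "\<bar>a \<mu>\<bar>"] r0[OF that]
    by (simp add: abs_mult mult.assoc)
  have b2: "\<bar>- r \<mu> * (- r \<mu> * a \<mu>)\<bar> \<le> K\<^sup>2 * (\<mu>\<^sup>2 * \<bar>a \<mu>\<bar>)" if "\<mu> \<in> M" for \<mu>
  proof -
    have "(r \<mu>)\<^sup>2 \<le> (K * \<mu>)\<^sup>2" using r0[OF that] rK[OF that] by (intro power_mono) auto
    from mult_right_mono[OF this, of "\<bar>a \<mu>\<bar>"] show ?thesis
      by (simp add: abs_mult power_mult_distrib power2_eq_square mult_ac abs_of_nonneg[OF r0[OF that]])
  qed
  have b3: "\<bar>\<mu> * a \<mu>\<bar> \<le> 1 * (\<mu>\<^sup>2 * \<bar>a \<mu>\<bar>)" if "\<mu> \<in> M" for \<mu>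
    using bs[OF that, of 1] M1[OF that] by simp
  have b4: "\<bar>\<mu> powr \<alpha> * (- r \<mu> * a \<mu>)\<bar> \<le> K * (\<mu> ^ 4 * \<bar>a \<mu>\<bar>)" if "\<mu> \<in> M" for \<mu>
  proof -
    have "\<mu> powr \<alpha> \<le> \<mu> powr 2" using M1[OF that] \<open>\<alpha> \<le> 1\<close> by (intro powr_mono) auto
    then have "\<mu> powr \<alpha> * \<bar>- r \<mu> * a \<mu>\<bar> \<le> \<mu>\<^sup>2 * (K * (\<mu>\<^sup>2 * \<bar>a \<mu>\<bar>))"
      using b1[OF that] M1[OF that] by (intro mult_mono) auto
    then show ?thesis by (simp add: abs_mult power2_eq_square power4_eq_xxxx mult_ac)
  qed
  let ?a1 = "\<lambda>\<mu>. - r \<mu> * a \<mu>" and ?a2 = "\<lambda>\<mu>. - r \<mu> * (- r \<mu> * a \<mu>)"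
  have "K\<^sup>2 \<ge> 0" by simp
  have sqrt_sq: "square_summable M (\<lambda>\<mu>. \<mu> powr (1 / 2) * (a \<mu> * exp (- r \<mu> * t)))" if "t \<ge> 0" for t
    using sq[OF bs[of _ "1 / 2"] that] by (simp add: mult.assoc)
  show ?thesis
    unfolding energy_solution_def
  proof (intro conjI allI impI ballI)
    show "?E a t \<in> frac_dom D A (1 / 2)" if "t \<ge> 0" for t
      using sq[OF b0 that] sqrt_sq[OF that] by (intro synth_in_frac_dom) auto
    have "continuous_on {0..} (?E (\<lambda>\<mu>. \<mu> powr (1 / 2) * a \<mu>))"
      using cont[OF bs[of _ "1 / 2"]] by simp
    moreover have "frac_power D A (1 / 2) (?E a t) = ?E (\<lambda>\<mu>. \<mu> powr (1 / 2) * a \<mu>) t" if "t \<in> {0..}" for t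
      using frac_power_synth[OF sq[OF b0], of t "1 / 2"] that by (simp add: mult.assoc)
    ultimately show "continuous_on {0..} (\<lambda>t. frac_power D A (1 / 2) (?E a t))"
      by (subst continuous_on_cong[OF refl]) auto
    show "(?E a has_vector_derivative ?E ?a1 t) (at t within {0..})" if "t \<ge> 0" for t
      by (rule deriv[OF b0 that]) auto
    show "continuous_on {0..} (?E ?a1)" by (rule cont[OF b1 \<open>K \<ge> 0\<close>])
    fix w assume w: "w \<in> D"
    show "\<exists>g. continuous_on {0..} g \<and>
        (\<forall>t\<ge>0. ((\<lambda>s. ?E ?a1 s \<bullet> w) has_real_derivative g t) (at t within {0..}) \<and>
               g t + ?E a t \<bullet> A w + c * (?E ?a1 t \<bullet> frac_power D A \<alpha> w) = 0)"
    proof (intro exI conjI allI impI)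
      show "continuous_on {0..} (\<lambda>t. ?E ?a2 t \<bullet> w)"
        by (intro continuous_intros cont[OF b2 \<open>K\<^sup>2 \<ge> 0\<close>])
      fix t :: real assume t: "t \<ge> 0"
      show "((\<lambda>s. ?E ?a1 s \<bullet> w) has_real_derivative ?E ?a2 t \<bullet> w) (at t within {0..})"
        unfolding has_real_derivative_iff_has_vector_derivative
        by (rule bounded_linear.has_vector_derivative[OF bounded_linear_inner_left deriv[OF b1 t \<open>K \<ge> 0\<close>]])
      let ?f = "\<lambda>\<mu>. a \<mu> * exp (- r \<mu> * t)" and ?f1 = "\<lambda>\<mu>. ?a1 \<mu> * exp (- r \<mu> * t)"
        and ?f2 = "\<lambda>\<mu>. ?a2 \<mu> * exp (- r \<mu> * t)"
      have s: "square_summable M ?f" by (rule sq[OF b0 t]) auto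
      have s1: "square_summable M ?f1" by (rule sq[OF b1 t \<open>K \<ge> 0\<close>])
      have s2: "square_summable M ?f2" by (rule sq[OF b2 t \<open>K\<^sup>2 \<ge> 0\<close>])
      have s3: "square_summable M (\<lambda>\<mu>. \<mu> * ?f \<mu>)" using sq[OF b3 t] by (simp add: mult.assoc)
      have s4: "square_summable M (\<lambda>\<mu>. \<mu> powr \<alpha> * ?f1 \<mu>)"
        using sq4[OF b4 t] by (simp only: mult.assoc)
      have pot: "synth ?f \<bullet> A w = synth (\<lambda>\<mu>. \<mu> * ?f \<mu>) \<bullet> w"
        using A_synth[OF s s3] symmetric[of "synth ?f" w] w by simp
      have damp: "synth ?f1 \<bullet> frac_power D A \<alpha> w = synth (\<lambda>\<mu>. \<mu> powr \<alpha> * ?f1 \<mu>) \<bullet> w"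
        by (rule synth_inner_frac_power[OF s1 s4 w \<open>\<alpha> \<le> 1\<close>])
      have total: "((\<lambda>\<mu>. (?f2 \<mu> * (e \<mu> \<bullet> w) + (\<mu> * ?f \<mu>) * (e \<mu> \<bullet> w))
            + c * ((\<mu> powr \<alpha> * ?f1 \<mu>) * (e \<mu> \<bullet> w))) has_sum
          (synth ?f2 \<bullet> w + synth (\<lambda>\<mu>. \<mu> * ?f \<mu>) \<bullet> w
            + c * (synth (\<lambda>\<mu>. \<mu> powr \<alpha> * ?f1 \<mu>) \<bullet> w))) M"
        by (intro has_sum_add has_sum_cmult_right inner_synth s2 s3 s4)
      have "((\<lambda>\<mu>. (?f2 \<mu> * (e \<mu> \<bullet> w) + (\<mu> * ?f \<mu>) * (e \<mu> \<bullet> w))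
            + c * ((\<mu> powr \<alpha> * ?f1 \<mu>) * (e \<mu> \<bullet> w))) has_sum 0) M"
      proof (rule has_sum_0)
        fix \<mu> assume "\<mu> \<in> M"
        have "(?f2 \<mu> * (e \<mu> \<bullet> w) + (\<mu> * ?f \<mu>) * (e \<mu> \<bullet> w)) + c * ((\<mu> powr \<alpha> * ?f1 \<mu>) * (e \<mu> \<bullet> w))
            = ((r \<mu>)\<^sup>2 - c * \<mu> powr \<alpha> * r \<mu> + \<mu>) * (?f \<mu> * (e \<mu> \<bullet> w))"
          by (simp add: power2_eq_square algebra_simps)
        also have "\<dots> = 0" by (simp only: root[OF \<open>\<mu> \<in> M\<close>] mult_zero_left)
        finally show "(?f2 \<mu> * (e \<mu> \<bullet> w) + (\<mu> * ?f \<mu>) * (e \<mu> \<bullet> w))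
            + c * ((\<mu> powr \<alpha> * ?f1 \<mu>) * (e \<mu> \<bullet> w)) = 0" .
      qed
      with total have "synth ?f2 \<bullet> w + synth (\<lambda>\<mu>. \<mu> * ?f \<mu>) \<bullet> w
            + c * (synth (\<lambda>\<mu>. \<mu> powr \<alpha> * ?f1 \<mu>) \<bullet> w) = 0"
        by (rule has_sum_unique)
      then show "?E ?a2 t \<bullet> w + ?E a t \<bullet> A w + c * (?E ?a1 t \<bullet> frac_power D A \<alpha> w) = 0"
        by (simp only: pot damp)
    qed
  qed
qed

lemma square_summable_power_exp:
  fixes a r :: "real \<Rightarrow> real"
  assumes a: "square_summable M a" and M1: "\<And>\<mu>. \<mu> \<in> M \<Longrightarrow> 1 \<le> \<mu>"
    and "\<kappa> > 0" "\<theta> > 0" and r: "\<And>\<mu>. \<mu> \<in> M \<Longrightarrow> \<kappa> * \<mu> powr \<theta> \<le> r \<mu>" and "t > 0"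
  shows "square_summable M (\<lambda>\<mu>. \<mu> ^ j * (a \<mu> * exp (- r \<mu> * t)))"
proof -
  obtain B where B: "\<And>x. x \<ge> 1 \<Longrightarrow> x ^ j * exp (- (\<kappa> * t) * x powr \<theta>) \<le> B"
    using power_exp_bounded[of "\<kappa> * t" \<theta> j] \<open>\<kappa> > 0\<close> \<open>\<theta> > 0\<close> \<open>t > 0\<close> by auto
  have a': "square_summable M (\<lambda>\<mu>. \<bar>a \<mu>\<bar>)" using a by (simp add: square_summable_def)
  show ?thesis
  proof (rule square_summable_mono[OF a'])
    fix \<mu> assume \<mu>: "\<mu> \<in> M"
    have "(\<kappa> * \<mu> powr \<theta>) * t \<le> r \<mu> * t" using r[OF \<mu>] \<open>t > 0\<close> by (intro mult_right_mono) auto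
    then have "\<mu> ^ j * exp (- r \<mu> * t) \<le> \<mu> ^ j * exp (- (\<kappa> * t) * \<mu> powr \<theta>)"
      using M1[OF \<mu>] by (intro mult_left_mono) (auto simp: mult_ac)
    then have "\<mu> ^ j * exp (- r \<mu> * t) \<le> B" using B[OF M1[OF \<mu>]] by linarith
    from mult_right_mono[OF this, of "\<bar>a \<mu>\<bar>"]
    show "\<bar>\<mu> ^ j * (a \<mu> * exp (- r \<mu> * t))\<bar> \<le> B * \<bar>a \<mu>\<bar>"
      using M1[OF \<mu>] by (simp add: abs_mult mult_ac)
  qed
qed

end

section \<open>Density and growth of the eigenvalues\<close>

text \<open>
  A value of the sequence is attained, so its multiplicity \<open>dim\<close> is positive, whereas a trivial
  eigenspace has dimension 0.
\<close>

lemma eigenvalue_sequence_in_eigenvalues: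
  fixes D :: "'a::real_vector set"
  assumes "eigenvalue_sequence D A l" "n \<ge> 1"
  shows "l n \<in> eigenvalues D A"
proof (rule ccontr)
  assume "l n \<notin> eigenvalues D A"
  then have "eigenspace D A (l n) \<subseteq> span {}" by (auto simp: eigenvalues_def)
  then have "dim (eigenspace D A (l n)) = 0"
    using dim_le_card[of "eigenspace D A (l n)" "{}"] by simp
  define S where "S = {m \<in> {1..}. l m = l n}"
  have "finite S \<and> card S = dim (eigenspace D A (l n))"
    unfolding S_def using assms(1) unfolding eigenvalue_sequence_def by blast
  with \<open>dim (eigenspace D A (l n)) = 0\<close> have "S = {}" by auto
  moreover have "n \<in> S" using assms(2) by (simp add: S_def)
  ultimately show False by simp
qed

text \<open>
  The first index at which the sequence reaches \<open>X\<close> overshoots by at most the factor \<open>C\<close>: there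
  are no large spectral gaps on a logarithmic scale.
\<close>

lemma sequence_hits_interval:
  fixes l :: "nat \<Rightarrow> real"
  assumes unbounded: "\<exists>n\<ge>1. X \<le> l n"
    and ratio: "\<And>n. n \<ge> 1 \<Longrightarrow> l (n + 1) \<le> C * l n" and "C \<ge> 1" and X: "l 1 \<le> X" "0 \<le> X"
  shows "\<exists>n\<ge>1. X \<le> l n \<and> l n \<le> C * X"
proof -
  \<comment> \<open>Minimality bounds the predecessor by \<open>X\<close>; at \<open>n = 1\<close>, which has none, \<open>l 1 \<le> X\<close> is used instead.\<close>
  define n where "n = (LEAST n. n \<ge> 1 \<and> X \<le> l n)"
  have n: "n \<ge> 1 \<and> X \<le> l n" unfolding n_def by (rule LeastI_ex[OF unbounded])
  have "l n \<le> C * X"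
  proof (cases "n = 1")
    case True
    then show ?thesis using X \<open>C \<ge> 1\<close> mult_right_mono[of 1 C X] by simp
  next
    case False
    define m where "m = n - 1"
    have m: "n = m + 1" "m \<ge> 1" using False n by (auto simp: m_def)
    have "m < n" using m by simp
    from not_less_Least[OF this[unfolded n_def]]
    have "C * l m \<le> C * X" using m(2) \<open>C \<ge> 1\<close> by (intro mult_left_mono) auto
    then show ?thesis using ratio[OF m(2)] m(1) by simp
  qed
  with n show ?thesis by blast
qed

text \<open>
  The squares are dominated by a multiple of \<open>1 / n\<^sup>2\<close>. The sum runs over the distinct values of
  the sequence, so one index is selected for each value.
\<close>

lemma square_summable_image_powr:
  fixes l :: "nat \<Rightarrow> real"
  assumes growth: "\<And>n. n \<in> N \<Longrightarrow> \<delta> * real n powr \<epsilon> \<le> l n" and N: "N \<subseteq> {1..}" and "\<epsilon> > 0" "\<delta> > 0"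
  shows "square_summable (l ` N) (\<lambda>\<mu>. \<mu> powr (- 1 / \<epsilon>))"
proof -
  let ?n = "inv_into N l"
  have "(\<lambda>n. 1 / real n ^ 2) summable_on UNIV"
    using inverse_power_summable[of 2, where 'a = real]
    by (intro norm_summable_imp_summable_on) (simp add: inverse_eq_divide)
  then have "(\<lambda>n. 1 / real n ^ 2) summable_on (?n ` (l ` N))"
    by (rule summable_on_subset_banach) auto
  then have "(\<lambda>\<mu>. 1 / real (?n \<mu>) ^ 2) summable_on (l ` N)"
    by (simp add: summable_on_reindex inj_on_inv_into o_def)
  then have *: "(\<lambda>\<mu>. (\<delta> powr (- 1 / \<epsilon>))\<^sup>2 * (1 / real (?n \<mu>) ^ 2)) summable_on (l ` N)"
    by (rule summable_on_cmult_right)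
  show ?thesis
    unfolding square_summable_def
  proof (rule summable_on_comparison_test[OF *])
    fix \<mu> assume \<mu>: "\<mu> \<in> l ` N"
    define n where "n = ?n \<mu>"
    have n: "n \<in> N" "l n = \<mu>" using \<mu> by (auto simp: n_def inv_into_into f_inv_into_f)
    have "n \<ge> 1" using n N by auto
    have "\<mu> powr (- 1 / \<epsilon>) \<le> (\<delta> * real n powr \<epsilon>) powr (- 1 / \<epsilon>)"
      using growth[OF n(1)] n(2) \<open>n \<ge> 1\<close> \<open>\<epsilon> > 0\<close> \<open>\<delta> > 0\<close> by (intro powr_mono2') auto
    also have "\<dots> = \<delta> powr (- 1 / \<epsilon>) * (1 / real n)"
      using \<open>n \<ge> 1\<close> \<open>\<epsilon> > 0\<close> \<open>\<delta> > 0\<close> by (simp add: powr_mult powr_powr powr_minus_divide)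
    finally have "(\<mu> powr (- 1 / \<epsilon>))\<^sup>2 \<le> (\<delta> powr (- 1 / \<epsilon>) * (1 / real n))\<^sup>2"
      by (intro power_mono) auto
    then show "(\<mu> powr (- 1 / \<epsilon>))\<^sup>2 \<le> (\<delta> powr (- 1 / \<epsilon>))\<^sup>2 * (1 / real (?n \<mu>) ^ 2)"
      by (simp add: power_mult_distrib power_divide n_def)
  qed auto
qed

section \<open>A solution of limited regularity\<close>

theorem theorem4p1:
  fixes D :: "'a::{real_inner, complete_space} set"
    and A :: "'a \<Rightarrow> 'a"
    and l :: "nat \<Rightarrow> real"
    and \<epsilon> \<delta> C c \<alpha> :: real
  assumes "infinite_dimensional TYPE('a)"
    and "selfadjoint_operator D A"
    and "coercive_operator D A"
    and "compact_inverse D A"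
    and "eigenvalue_sequence D A l"
    and "\<epsilon> > 0" "\<delta> > 0" "\<forall>n\<ge>1. l n \<ge> \<delta> * real n powr \<epsilon>"
    and "C > 1" "\<forall>n\<ge>1. l (n + 1) \<le> C * l n"
    and "c > 0" "1/2 < \<alpha>" "\<alpha> < 1"
  shows "\<exists>u u' u\<^sub>0 u\<^sub>1 d.
           u\<^sub>0 \<in> frac_dom D A (1/2) \<and>
           energy_solution D A c \<alpha> u u' \<and> u 0 = u\<^sub>0 \<and> u' 0 = u\<^sub>1 \<and>
           (\<forall>t>0. d t > (0::real)) \<and>
           (\<forall>k::nat. k \<ge> 1 \<longrightarrow> (\<forall>t>0. u t \<in> power_domain D A k \<and>
              norm ((A ^^ k) (u t)) \<ge> (d t * real k) powr (real k / (1 - \<alpha>))))"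
proof -
  interpret coercive_selfadjoint D A by unfold_locales fact+
  define \<theta> where "\<theta> = 1 - \<alpha>"
  have \<theta>: "\<theta> > 0" "\<theta> \<le> 1" using assms by (auto simp: \<theta>_def)
  \<comment> \<open>Beyond \<open>X\<^sub>0\<close> the discriminant \<open>c\<^sup>2 \<mu>\<^sup>2\<^sup>\<alpha> - 4 \<mu>\<close> is nonnegative, because \<open>2 \<alpha> > 1\<close>; the other terms
     give \<open>\<mu> \<ge> 1\<close> and the starting point needed to find eigenvalues in \<open>[X, C X]\<close>.\<close>
  define X\<^sub>0 where "X\<^sub>0 = max (max 1 (l 1)) ((4 / c\<^sup>2) powr (1 / (2 * \<alpha> - 1)))"
  have X0: "1 \<le> X\<^sub>0" "l 1 \<le> X\<^sub>0" "(4 / c\<^sup>2) powr (1 / (2 * \<alpha> - 1)) \<le> X\<^sub>0" by (auto simp: X\<^sub>0_def)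
  define N where "N = {n. n \<ge> 1 \<and> X\<^sub>0 \<le> l n}"
  define M where "M = l ` N"
  have M_ge: "X\<^sub>0 \<le> \<mu>" if "\<mu> \<in> M" for \<mu> using that by (auto simp: M_def N_def)
  then have M1: "1 \<le> \<mu>" if "\<mu> \<in> M" for \<mu> using X0(1) that by force
  have M_sub: "M \<subseteq> \<sigma>"
    using eigenvalue_sequence_in_eigenvalues[OF assms(5)] by (auto simp: M_def N_def)
  have "\<exists>v. v \<in> E \<mu> \<and> norm v = 1" if "\<mu> \<in> \<sigma>" for \<mu>
  proof -
    obtain w where "w \<in> E \<mu>" "w \<noteq> 0" using \<open>\<mu> \<in> \<sigma>\<close> by (auto simp: eigenvalues_def)
    then show ?thesis
      by (intro exI[of _ "w /\<^sub>R norm w"]) (simp add: subspace_scale[OF subspace_eigenspace])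
  qed
  then obtain e where e: "\<And>\<mu>. \<mu> \<in> M \<Longrightarrow> e \<mu> \<in> E \<mu>" "\<And>\<mu>. \<mu> \<in> M \<Longrightarrow> norm (e \<mu>) = 1"
    using M_sub by (metis subsetD)
  interpret eigenvector_family D A M e by unfold_locales (use M_sub e in auto)
  have "\<exists>r. r\<^sup>2 - c * \<mu> powr \<alpha> * r + \<mu> = 0 \<and> \<mu> powr \<theta> / c \<le> r \<and> r \<le> 2 / c * \<mu> powr \<theta>"
    if "\<mu> \<in> M" for \<mu>
    unfolding \<theta>_def
  proof (rule slow_root)
    show "\<mu> > 0" using M1[OF that] by simp
    have "4 / c\<^sup>2 = ((4 / c\<^sup>2) powr (1 / (2 * \<alpha> - 1))) powr (2 * \<alpha> - 1)"
      using assms by (simp add: powr_powr)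
    also have "\<dots> \<le> \<mu> powr (2 * \<alpha> - 1)"
      using X0(3) M_ge[OF that] assms by (intro powr_mono2) auto
    also have "\<dots> = (\<mu> powr \<alpha>)\<^sup>2 / \<mu>"
      using \<open>\<mu> > 0\<close> by (simp add: powr_diff powr_power)
    finally show "4 * \<mu> \<le> (c * \<mu> powr \<alpha>)\<^sup>2"
      using \<open>\<mu> > 0\<close> \<open>c > 0\<close> by (simp add: field_simps power_mult_distrib)
  qed fact
  then obtain r where root: "\<And>\<mu>. \<mu> \<in> M \<Longrightarrow> (r \<mu>)\<^sup>2 - c * \<mu> powr \<alpha> * r \<mu> + \<mu> = 0"
    and r_lower: "\<And>\<mu>. \<mu> \<in> M \<Longrightarrow> \<mu> powr \<theta> / c \<le> r \<mu>"
    and r_upper: "\<And>\<mu>. \<mu> \<in> M \<Longrightarrow> r \<mu> \<le> 2 / c * \<mu> powr \<theta>"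
    by metis
  have r0: "0 \<le> r \<mu>" if "\<mu> \<in> M" for \<mu>
    using order_trans[OF _ r_lower[OF that]] \<open>c > 0\<close> by simp
  have rK: "r \<mu> \<le> 2 / c * \<mu>" if "\<mu> \<in> M" for \<mu>
  proof -
    have "\<mu> powr \<theta> \<le> \<mu> powr 1" using M1[OF that] \<theta> by (intro powr_mono) auto
    then have "2 / c * \<mu> powr \<theta> \<le> 2 / c * \<mu>"
      using M1[OF that] \<open>c > 0\<close> by (intro mult_left_mono) auto
    then show ?thesis using r_upper[OF that] by linarith
  qed
  \<comment> \<open>Four powers for the time derivatives, and \<open>1 / \<epsilon>\<close> for the sum over the eigenvalues.\<close>
  define p where "p = 4 + 1 / \<epsilon>"
  have "p \<ge> 0" using \<open>\<epsilon> > 0\<close> by (simp add: p_def)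
  define a where "a \<mu> = \<mu> powr (- p)" for \<mu> :: real
  have base: "square_summable M (\<lambda>\<mu>. \<mu> powr (- 1 / \<epsilon>))"
    unfolding M_def by (rule square_summable_image_powr[where \<delta> = \<delta>]) (use assms in \<open>auto simp: N_def\<close>)
  have a4: "square_summable M (\<lambda>\<mu>. \<mu> ^ 4 * a \<mu>)"
  proof (rule square_summable_mono[OF base, where K = 1])
    fix \<mu> assume "\<mu> \<in> M"
    then have "\<mu> ^ 4 * a \<mu> = \<mu> powr (4 + - p)"
      using M1[of \<mu>] unfolding powr_add by (simp add: a_def)
    then show "\<bar>\<mu> ^ 4 * a \<mu>\<bar> \<le> 1 * \<mu> powr (- 1 / \<epsilon>)" by (simp add: p_def)
  qed
  have a0: "square_summable M a"
  proof (rule square_summable_mono[OF a4, where K = 1])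
    fix \<mu> assume "\<mu> \<in> M"
    then show "\<bar>a \<mu>\<bar> \<le> 1 * (\<mu> ^ 4 * a \<mu>)"
      using M1[of \<mu>] mult_right_mono[of 1 "\<mu> ^ 4" "a \<mu>"] by (simp add: a_def)
  qed
  define u where "u t = synth (\<lambda>\<mu>. a \<mu> * exp (- r \<mu> * t))" for t
  define u' where "u' t = synth (\<lambda>\<mu>. - r \<mu> * a \<mu> * exp (- r \<mu> * t))" for t
  define d where "d t = exp (- ((C * X\<^sub>0) powr \<theta> * (\<theta> * (2 / c) * t + p)))" for t
  have sol: "energy_solution D A c \<alpha> u u'"
    unfolding u_def[abs_def] u'_def[abs_def]
    by (rule modes_energy_solution[OF _ _ M1 root r0 rK a4]) (use assms in auto)
  have smooth: "square_summable M (\<lambda>\<mu>. \<mu> ^ j * (a \<mu> * exp (- r \<mu> * t)))" if "t > 0" for j t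
    by (rule square_summable_power_exp[OF a0 M1, where \<kappa> = "1 / c" and \<theta> = \<theta>])
      (use r_lower \<open>c > 0\<close> \<theta> that in auto)
  have unbounded: "\<exists>n\<ge>1. X \<le> l n" if "X > 0" for X
  proof -
    obtain n :: nat where n: "(X / \<delta>) powr (1 / \<epsilon>) \<le> real n" using real_arch_simple by blast
    have "(X / \<delta>) powr (1 / \<epsilon>) > 0" using that \<open>\<delta> > 0\<close> by simp
    then have "real n > 0" using n by linarith
    have "X / \<delta> = ((X / \<delta>) powr (1 / \<epsilon>)) powr \<epsilon>"
      using that \<open>\<epsilon> > 0\<close> \<open>\<delta> > 0\<close> by (simp add: powr_powr)
    also have "\<dots> \<le> real n powr \<epsilon>" using n \<open>\<epsilon> > 0\<close> by (intro powr_mono2) auto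
    finally have "X \<le> \<delta> * real n powr \<epsilon>" using \<open>\<delta> > 0\<close> by (simp add: field_simps)
    moreover have "n \<ge> 1" using \<open>real n > 0\<close> by simp
    ultimately show ?thesis using assms(8) by (meson order_trans)
  qed
  have bound: "(d t * real k) powr (real k / (1 - \<alpha>)) \<le> norm ((A ^^ k) (u t))" if "k \<ge> 1" "t > 0" for k t
  proof -
    let ?X = "max X\<^sub>0 (real k powr (1 / \<theta>))"
    \<comment> \<open>A single coefficient bounds the norm from below, so one eigenvalue of the right size is enough.\<close>
    obtain n where n: "n \<ge> 1" "?X \<le> l n" "l n \<le> C * ?X"
      using sequence_hits_interval[OF unbounded, of ?X C] assms X0 by force
    then have \<mu>: "l n \<in> M" by (auto simp: M_def N_def)
    have "(d t * real k) powr (real k / \<theta>) \<le> l n ^ k * (a (l n) * exp (- r (l n) * t))"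
      unfolding d_def a_def
      by (rule mode_lower_bound[OF \<theta>(1) _ X0(1) \<open>p \<ge> 0\<close> _ _ that(1) refl n(2,3) r_upper[OF \<mu>]])
        (use assms that in auto)
    also have "\<dots> \<le> norm (synth (\<lambda>\<mu>. \<mu> ^ k * (a \<mu> * exp (- r \<mu> * t))))"
      by (rule coeff_le_norm_synth[OF smooth[OF that(2)] \<mu>])
    also have "\<dots> = norm ((A ^^ k) (u t))"
      unfolding u_def by (subst A_power_synth(1)) (use smooth that in auto)
    finally show ?thesis by (simp add: \<theta>_def)
  qed
  have "u t \<in> power_domain D A k" if "t > 0" for k t
    unfolding u_def by (rule A_power_synth(2)) (rule smooth[OF that])
  moreover have "u 0 \<in> frac_dom D A (1 / 2)" using sol by (simp add: energy_solution_def)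
  moreover have "d t > 0" for t by (simp add: d_def)
  ultimately show ?thesis using sol bound by blast
qed

end
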